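(* Let $1<p_i<\infty$ for $i\in\mathbb N$, and $\frac1p=\sum_{i=1}^\infty\frac1{p_i}$. Let $\omega_i$ ($i\in\mathbb N$) be weights on $\mathbb R^n$ satisfying the standing assumptions listed in the context. If $\sum_{i=1}^\infty\frac{\ln p_i}{p_i}<\infty$ and the weight vector $\overrightarrow\omega=(\omega_1,\omega_2,\dots)$ satisfies the condition $A^*_{\overrightarrow p}$, then $$\|\mathfrak M_d(\overrightarrow f)\|_{L^p(v)}\le C\prod_{i=1}^\infty\|f_i\|_{L^{p_i}(\omega_i)},\quad\forall\overrightarrow f\in\prod_{i=1}^\infty L^{p_i}(\omega_i),$$ where $v=\prod_{i=1}^\infty\omega_i^{\frac{p}{p_i}}$ and $$C=\prod_{i=1}^\infty[\omega_i]_{A_{p_i}}^{\frac{p_i'}{p_i}}\prod_{i=1}^\infty p_i^{\frac{p_i'}{p_i}}\prod_{i=1}^\infty p_i'.$$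
   Context: A weight is a positive locally integrable function on $\mathbb R^n$. $|B|$ is Lebesgue measure, $\omega(B)=\int_B\omega\,dx$, $\frac1{p_i}+\frac1{p_i'}=1$, and $\|f\|_{L^{q}(\omega)}=(\int_{\mathbb R^n}|f|^q\omega\,dx)^{1/q}$. An infinite product $\prod_{i=1}^\infty c_i$ denotes $\lim_{n\to\infty}\prod_{i=1}^n c_i$; it converges if this limit exists (the limit may be $0$), and for nonnegative $c_i$ writing $\prod c_i<\infty$ means that it converges to a finite limit. The infinite product defining $v$ is understood to be well defined (convergent). Dyadic cubes: for $k\in\mathbb Z$, $\mathcal D_k$ is the family of half-open cubes $2^{-k}(m+[0,1)^n)$, $m\in\mathbb Z^n$, and $\mathcal D=\bigcup_{k\in\mathbb Z}\mathcal D_k$. For locally integrable $f$, $E_k(f)(x)=\sum_{B\in\mathcal D_k}\big(\frac1{|B|}\int_B f(y)\,dy\big)\chi_B(x)$. Generalized dyadic maximal operator: for $\overrightarrow f=(f_1,f_2,\dots)$, $$\mathfrak M_d(\overrightarrow f)(x)=\sup_{x\in B\in\mathcal D}\prod_{i=1}^{\infty}\frac{1}{|B|}\int_B|f_i(y_i)|\,dy_i .$$ For $1<q<\infty$ and a weight $\omega$, $[\omega]_{A_q}=\sup_{B\in\mathcal D}\frac{\omega(B)}{|B|}\Big(\frac1{|B|}\int_B\omega^{-\frac1{q-1}}dx\Big)^{q-1}$, and $\omega\in A_q$ means $[\omega]_{A_q}<\infty$. The weight vector $\overrightarrow\omega$ satisfies the condition $A^*_{\overrightarrow p}$ if $\omega_i\in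 A_{p_i}$ for all $i\in\mathbb N$ and $\prod_{i=1}^\infty[\omega_i]_{A_{p_i}}^{1/p_i}<\infty$. $\overrightarrow f\in\prod_{i=1}^\infty L^{p_i}(\omega_i)$ means that the $f_i$ are nonnegative measurable functions on $\mathbb R^n$ with $f_i\in L^{p_i}(\omega_i)$ and $\prod_{i=1}^\infty\|f_i\|_{L^{p_i}(\omega_i)}<\infty$. Standing assumptions, with $\sigma_i=\omega_i^{-\frac1{p_i-1}}=\omega_i^{1-p_i'}$: the sum $\frac1p=\sum_i\frac1{p_i}$ is finite (so $0<p<\infty$); $\prod_{i=1}^\infty E_k(\sigma_i)^{1/p_i'}<\infty$ for all $k\in\mathbb Z$; $\prod_{i=1}^\infty\sigma_i^{1/p_i}>0$; and for every $B\in\mathcal D$, $(\sigma_1\chi_B,\sigma_2\chi_B,\dots)\in\prod_{i=1}^\infty L^{p_i}(\omega_i)$. *)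

theory Defs
  imports "HOL-Analysis.Analysis"
begin

text \<open>
  Quantities that are nonnegative and possibly infinite (averages, norms, weight constants,
  maximal functions) take values in \<^typ>\<open>ennreal\<close>. Integrals are with respect to
  \<^term>\<open>lebesgue\<close>, and pointwise conditions on functions are read almost everywhere.
  The index set of the sequences is \<^typ>\<open>nat\<close>, starting at 0.
\<close>


subsection \<open>Powers and infinite products\<close>

text \<open>Only meant for exponents \<open>a > 0\<close>, whence the value at \<open>\<infinity>\<close>.\<close>
definition enn_powr :: "ennreal \<Rightarrow> real \<Rightarrow> ennreal" where
  "enn_powr x a = (if x = \<infinity> then \<infinity> else ennreal (enn2real x powr a))"

text \<open>
  The product is the plain limit of the partial products, and a limit 0 counts as convergence;
  this differs from \<^const>\<open>convergent_prod\<close> and \<^const>\<open>prodinf\<close> of the library.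
  \<open>inf_prod_conv\<close> allows the limit \<open>\<infinity>\<close>, \<open>inf_prod_finite\<close> does not.
\<close>
definition inf_prod :: "(nat \<Rightarrow> ennreal) \<Rightarrow> ennreal" where
  "inf_prod c = lim (\<lambda>n. \<Prod>i<n. c i)"

definition inf_prod_conv :: "(nat \<Rightarrow> ennreal) \<Rightarrow> bool" where
  "inf_prod_conv c \<longleftrightarrow> convergent (\<lambda>n. \<Prod>i<n. c i)"

definition inf_prod_finite :: "(nat \<Rightarrow> ennreal) \<Rightarrow> bool" where
  "inf_prod_finite c \<longleftrightarrow> inf_prod_conv c \<and> inf_prod c < \<infinity>"

definition conj_exp :: "real \<Rightarrow> real" where
  "conj_exp q = q / (q - 1)"

lemma conj_exp: "1 < q \<Longrightarrow> 1 / q + 1 / conj_exp q = 1"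
  by (simp add: conj_exp_def divide_simps)


subsection \<open>Dyadic cubes and averages\<close>

definition dyadic_cube :: "int \<Rightarrow> (int ^ 'n) \<Rightarrow> (real ^ 'n) set" where
  "dyadic_cube k m =
     {x. \<forall>j. 2 powi (- k) * of_int (m $ j) \<le> x $ j \<and> x $ j < 2 powi (- k) * (of_int (m $ j) + 1)}"

definition dyadic_gen :: "int \<Rightarrow> (real ^ 'n) set set" where
  "dyadic_gen k = range (dyadic_cube k)"

definition dyadic :: "(real ^ 'n) set set" where
  "dyadic = (\<Union>k. dyadic_gen k)"

definition avg :: "(real ^ 'n) set \<Rightarrow> (real ^ 'n \<Rightarrow> ennreal) \<Rightarrow> ennreal" where
  "avg B f = (\<integral>\<^sup>+y\<in>B. f y \<partial>lebesgue) / emeasure lebesgue B"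

text \<open>\<open>E\<^sub>k\<close>, for nonnegative functions.\<close>
definition dyadic_E :: "int \<Rightarrow> (real ^ 'n \<Rightarrow> ennreal) \<Rightarrow> real ^ 'n \<Rightarrow> ennreal" where
  "dyadic_E k f x = (\<Sum>\<^sub>\<infinity>B\<in>dyadic_gen k. avg B f * indicator B x)"

definition gen_max :: "(nat \<Rightarrow> real ^ 'n \<Rightarrow> real) \<Rightarrow> real ^ 'n \<Rightarrow> ennreal" where
  "gen_max f x = (SUP B\<in>{B \<in> dyadic. x \<in> B}. inf_prod (\<lambda>i. avg B (\<lambda>y. ennreal \<bar>f i y\<bar>)))"


subsection \<open>Weights and weighted spaces\<close>

definition weight :: "(real ^ 'n \<Rightarrow> real) \<Rightarrow> bool" where
  "weight w \<longleftrightarrow> w \<in> borel_measurable lebesgue \<and> (AE x in lebesgue. 0 < w x) \<and>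
     (\<forall>K. compact K \<longrightarrow> set_integrable lebesgue K w)"

definition dual_weight :: "real \<Rightarrow> (real ^ 'n \<Rightarrow> real) \<Rightarrow> real ^ 'n \<Rightarrow> real" where
  "dual_weight q w x = w x powr (- 1 / (q - 1))"

definition Lp_norm :: "real \<Rightarrow> (real ^ 'n \<Rightarrow> ennreal) \<Rightarrow> (real ^ 'n \<Rightarrow> ennreal) \<Rightarrow> ennreal" where
  "Lp_norm q w g = enn_powr (\<integral>\<^sup>+x. enn_powr (g x) q * w x \<partial>lebesgue) (1 / q)"

definition Lp_norm_real :: "real \<Rightarrow> (real ^ 'n \<Rightarrow> real) \<Rightarrow> (real ^ 'n \<Rightarrow> real) \<Rightarrow> ennreal" where
  "Lp_norm_real q w f = Lp_norm q (\<lambda>x. ennreal (w x)) (\<lambda>x. ennreal \<bar>f x\<bar>)"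

definition Lp_prod ::
  "(nat \<Rightarrow> real) \<Rightarrow> (nat \<Rightarrow> real ^ 'n \<Rightarrow> real) \<Rightarrow> (nat \<Rightarrow> real ^ 'n \<Rightarrow> real) set" where
  "Lp_prod ps w = {f.
     (\<forall>i. f i \<in> borel_measurable lebesgue \<and> (AE x in lebesgue. 0 \<le> f i x) \<and>
          Lp_norm_real (ps i) (w i) (f i) < \<infinity>) \<and>
     inf_prod_finite (\<lambda>i. Lp_norm_real (ps i) (w i) (f i))}"

definition A_const :: "real \<Rightarrow> (real ^ 'n \<Rightarrow> real) \<Rightarrow> ennreal" where
  "A_const q w = (SUP B\<in>dyadic.
     avg B (\<lambda>x. ennreal (w x)) * enn_powr (avg B (\<lambda>x. ennreal (dual_weight q w x))) (q - 1))"

definition A_class :: "real \<Rightarrow> (real ^ 'n \<Rightarrow> real) set" where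
  "A_class q = {w. weight w \<and> A_const q w < \<infinity>}"

definition A_star :: "(nat \<Rightarrow> real) \<Rightarrow> (nat \<Rightarrow> real ^ 'n \<Rightarrow> real) \<Rightarrow> bool" where
  "A_star ps w \<longleftrightarrow> (\<forall>i. w i \<in> A_class (ps i)) \<and>
     inf_prod_finite (\<lambda>i. enn_powr (A_const (ps i) (w i)) (1 / ps i))"

definition prod_weight ::
  "real \<Rightarrow> (nat \<Rightarrow> real) \<Rightarrow> (nat \<Rightarrow> real ^ 'n \<Rightarrow> real) \<Rightarrow> real ^ 'n \<Rightarrow> ennreal" where
  "prod_weight p ps w x = inf_prod (\<lambda>i. ennreal (w i x powr (p / ps i)))"

end

theory Submission
  imports Defs
begin

text \<open>
  The operator \<^const>\<open>gen_max\<close> is dominated by the product of the dyadic maximal functions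
  \<open>M f\<^sub>i\<close> of the components, and Holder's inequality with the infinitely many exponents
  \<open>p / p\<^sub>i\<close>, whose sum is 1, splits the \<open>L\<^sup>p(v)\<close> norm of that product into the norms of
  \<open>M f\<^sub>i\<close> in \<open>L\<close> with exponent \<open>p\<^sub>i\<close> and weight \<open>\<omega>\<^sub>i\<close>. A single weight is treated as in
  Lerner's proof of Buckley's theorem: with \<open>\<sigma>\<close> the dual weight and \<open>M\<^sub>\<mu>\<close> the dyadic maximal
  function of the measure \<open>\<mu>\<close>,
  \<open>(M f)\<^sup>q\<^sup>-\<^sup>1 \<le> [\<omega>] M\<^sub>\<omega> (M\<^sub>\<sigma>(f / \<sigma>)\<^sup>q\<^sup>-\<^sup>1 / \<omega>)\<close>,
  and each of the two outer operators is bounded by Doob's inequality, with the conjugate exponent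
  as constant. These two constants account for the second and the third product in \<open>C\<close>.
\<close>

subsection \<open>Powers and Holder inequalities for extended nonnegative functions\<close>

lemma enn_powr_top [simp]: "enn_powr top a = top"
  by (simp add: enn_powr_def)

lemma enn_powr_ennreal: "0 \<le> x \<Longrightarrow> enn_powr (ennreal x) a = ennreal (x powr a)"
  by (simp add: enn_powr_def)

lemma enn_powr_0 [simp]: "enn_powr 0 a = 0"
  by (simp add: enn_powr_def)

lemma enn_powr_one_base [simp]: "enn_powr 1 a = 1"
  by (simp add: enn_powr_def)

lemma enn_powr_one [simp]: "enn_powr x 1 = x"
  by (cases x) (auto simp: enn_powr_ennreal)

lemma enn_powr_eq_0_iff [simp]: "enn_powr x a = 0 \<longleftrightarrow> x = 0"
  by (cases x) (auto simp: enn_powr_ennreal)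

lemma enn_powr_eq_top_iff [simp]: "enn_powr x a = top \<longleftrightarrow> x = top"
  by (cases x) (auto simp: enn_powr_ennreal)

lemma enn_powr_mult: "enn_powr (x * y) a = enn_powr x a * enn_powr y a"
  by (cases x; cases y)
     (auto simp: enn_powr_ennreal ennreal_mult[symmetric] powr_mult ennreal_mult_top ennreal_top_mult)

lemma enn_powr_enn_powr: "enn_powr (enn_powr x a) b = enn_powr x (a * b)"
  by (cases x) (auto simp: enn_powr_ennreal powr_powr)

lemma enn_powr_add: "enn_powr x (a + b) = enn_powr x a * enn_powr x b"
  by (cases x) (auto simp: enn_powr_ennreal powr_add ennreal_mult)

lemma enn_powr_prod: "enn_powr (\<Prod>i\<in>I. f i) a = (\<Prod>i\<in>I. enn_powr (f i) a)"
  by (induction I rule: infinite_finite_induct) (auto simp: enn_powr_mult)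

lemma enn_powr_mono: "0 < a \<Longrightarrow> x \<le> y \<Longrightarrow> enn_powr x a \<le> enn_powr y a"
  by (cases x; cases y) (auto simp: enn_powr_ennreal top_unique powr_mono2)

lemma enn_powr_less_top: "x < top \<Longrightarrow> enn_powr x a < top"
  by (metis enn_powr_eq_top_iff top.not_eq_extremum)

lemma one_le_enn_powr: "0 < a \<Longrightarrow> 1 \<le> x \<Longrightarrow> 1 \<le> enn_powr x a"
  using enn_powr_mono[of a 1 x] by simp

lemma mono_enn_powr: "0 < a \<Longrightarrow> mono (\<lambda>x. enn_powr x a)"
  by (simp add: monoI enn_powr_mono)

lemma continuous_on_enn_powr:
  assumes "0 < a" shows "continuous_on UNIV (\<lambda>x. enn_powr x a)"
proof (rule continuous_onI_mono)
  have "y \<in> range (\<lambda>x. enn_powr x a)" for y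
    using assms by (intro image_eqI[of _ _ "enn_powr y (1 / a)"]) (auto simp: enn_powr_enn_powr)
  then have "range (\<lambda>x. enn_powr x a) = UNIV" by auto
  then show "open (range (\<lambda>x. enn_powr x a))" by simp
qed (use assms in \<open>simp add: enn_powr_mono\<close>)

lemma tendsto_enn_powr:
  assumes "0 < a" "(f \<longlongrightarrow> l) F" shows "((\<lambda>x. enn_powr (f x) a) \<longlongrightarrow> enn_powr l a) F"
  using continuous_on_tendsto_compose[OF continuous_on_enn_powr[OF assms(1)] assms(2)] by simp

lemma liminf_enn_powr:
  assumes "0 < a" shows "liminf (\<lambda>n. enn_powr (f n) a) = enn_powr (liminf f) a"
  by (intro Liminf_compose_continuous_mono continuous_on_enn_powr mono_enn_powr assms
      sequentially_bot)

lemma SUP_enn_powr: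
  assumes "0 < a" shows "(SUP i\<in>I. enn_powr (f i) a) = enn_powr (SUP i\<in>I. f i) a"
proof (rule antisym)
  show "(SUP i\<in>I. enn_powr (f i) a) \<le> enn_powr (SUP i\<in>I. f i) a"
    using assms by (intro SUP_least enn_powr_mono SUP_upper)
  have "f i \<le> enn_powr (SUP i\<in>I. enn_powr (f i) a) (1 / a)" if "i \<in> I" for i
    using enn_powr_mono[OF _ SUP_upper[OF that, of "\<lambda>i. enn_powr (f i) a"], of "1 / a"] assms
    by (simp add: enn_powr_enn_powr)
  then have "(SUP i\<in>I. f i) \<le> enn_powr (SUP i\<in>I. enn_powr (f i) a) (1 / a)"
    by (rule SUP_least)
  from enn_powr_mono[OF assms this] assms
  show "enn_powr (SUP i\<in>I. f i) a \<le> (SUP i\<in>I. enn_powr (f i) a)"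
    by (simp add: enn_powr_enn_powr)
qed

lemma measurable_enn_powr [measurable (raw)]:
  assumes [measurable]: "f \<in> borel_measurable M"
  shows "(\<lambda>x. enn_powr (f x) a) \<in> borel_measurable M"
  unfolding enn_powr_def by measurable

lemma weighted_arith_geom_mean:
  fixes a x :: "'i \<Rightarrow> real"
  assumes "finite I" "I \<noteq> {}" "(\<Sum>i\<in>I. a i) = 1" "\<And>i. i \<in> I \<Longrightarrow> 0 \<le> a i" "\<And>i. i \<in> I \<Longrightarrow> 0 < x i"
  shows "(\<Prod>i\<in>I. x i powr a i) \<le> (\<Sum>i\<in>I. a i * x i)"
proof -
  have "(\<Prod>i\<in>I. x i powr a i) = exp (\<Sum>i\<in>I. a i * ln (x i))"
    using assms(1) by (auto simp: exp_sum powr_def intro!: prod.cong dest!: assms(5))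
  also have "\<dots> \<le> (\<Sum>i\<in>I. a i * exp (ln (x i)))"
    using convex_on_sum[OF assms(1,2) exp_convex assms(3,4), of "\<lambda>i. ln (x i)"] by simp
  also have "\<dots> = (\<Sum>i\<in>I. a i * x i)"
    using assms(5) by (intro sum.cong) auto
  finally show ?thesis .
qed

lemma enn_weighted_arith_geom_mean:
  fixes x :: "'i \<Rightarrow> ennreal"
  assumes "finite I" "(\<Sum>i\<in>I. a i) = 1" "\<And>i. i \<in> I \<Longrightarrow> 0 < a i"
  shows "(\<Prod>i\<in>I. enn_powr (x i) (a i)) \<le> (\<Sum>i\<in>I. ennreal (a i) * x i)"
proof -
  consider i where "i \<in> I" "x i = 0" | i where "i \<in> I" "x i = top"
    | "\<And>i. i \<in> I \<Longrightarrow> 0 < x i \<and> x i < top"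
    by (metis gr_zeroI top.not_eq_extremum)
  then show ?thesis
  proof cases
    case 1
    then have "(\<Prod>i\<in>I. enn_powr (x i) (a i)) = 0"
      using assms(1) by (intro prod_zero) auto
    then show ?thesis by (metis zero_le)
  next
    case 2
    have "ennreal (a i) * x i \<le> (\<Sum>i\<in>I. ennreal (a i) * x i)"
      using assms(1) 2 by (intro member_le_sum) auto
    then show ?thesis
      using 2 assms(3)[of i] by (simp add: ennreal_mult_top top_unique)
  next
    case 3
    define y where "y i = enn2real (x i)" for i
    have y: "x i = ennreal (y i)" "0 < y i" if "i \<in> I" for i
      using 3[OF that] by (auto simp: y_def enn2real_positive_iff)
    have "(\<Prod>i\<in>I. enn_powr (x i) (a i)) = ennreal (\<Prod>i\<in>I. y i powr a i)"
      using y by (subst prod_ennreal[symmetric]) (auto intro!: prod.cong simp: enn_powr_ennreal less_imp_le)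
    also have "\<dots> \<le> ennreal (\<Sum>i\<in>I. a i * y i)"
      using assms y by (intro ennreal_leI weighted_arith_geom_mean) (auto simp: less_imp_le)
    also have "\<dots> = (\<Sum>i\<in>I. ennreal (a i) * x i)"
      using assms y by (subst sum_ennreal[symmetric]) (auto intro!: sum.cong simp: ennreal_mult less_imp_le)
    finally show ?thesis .
  qed
qed

lemma nn_integral_Holder_prod:
  fixes g :: "'i \<Rightarrow> 'a \<Rightarrow> ennreal"
  assumes I: "finite I" and a: "(\<Sum>i\<in>I. a i) = 1" "\<And>i. i \<in> I \<Longrightarrow> 0 < a i"
    and [measurable]: "\<And>i. i \<in> I \<Longrightarrow> g i \<in> borel_measurable M"
  shows "(\<integral>\<^sup>+x. (\<Prod>i\<in>I. enn_powr (g i x) (a i)) \<partial>M) \<le> (\<Prod>i\<in>I. enn_powr (\<integral>\<^sup>+x. g i x \<partial>M) (a i))"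
proof -
  define N where "N i = (\<integral>\<^sup>+x. g i x \<partial>M)" for i
  consider i where "i \<in> I" "N i = 0" | i where "i \<in> I" "N i = top" "\<And>j. j \<in> I \<Longrightarrow> N j \<noteq> 0"
    | "\<And>i. i \<in> I \<Longrightarrow> 0 < N i \<and> N i < top"
    by (metis gr_zeroI top.not_eq_extremum)
  then show ?thesis
  proof cases
    case 1
    then have "AE x in M. g i x = 0"
      by (simp add: N_def nn_integral_0_iff_AE)
    then have "AE x in M. (\<Prod>i\<in>I. enn_powr (g i x) (a i)) = 0"
      by eventually_elim (use 1 I in \<open>auto intro!: prod_zero\<close>)
    then have "(\<integral>\<^sup>+x. (\<Prod>i\<in>I. enn_powr (g i x) (a i)) \<partial>M) = (\<integral>\<^sup>+x. 0 \<partial>M)"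
      by (rule nn_integral_cong_AE)
    then show ?thesis by simp
  next
    case 2
    have "(\<Prod>i\<in>I. enn_powr (N i) (a i)) = top"
      using I 2 by (auto simp: ennreal_prod_eq_top)
    then show ?thesis by (simp add: N_def)
  next
    case 3
    have [simp]: "N i * (g i x / N i) = g i x" if "i \<in> I" for i x
      using 3[OF that] 
      by (metis ennreal_times_divide mult.commute mult_divide_eq_ennreal less_irrefl)
    have "(\<integral>\<^sup>+x. (\<Prod>i\<in>I. enn_powr (g i x) (a i)) \<partial>M)
        = (\<integral>\<^sup>+x. (\<Prod>i\<in>I. enn_powr (N i) (a i)) * (\<Prod>i\<in>I. enn_powr (g i x / N i) (a i)) \<partial>M)"
      by (intro nn_integral_cong)
        (auto simp: prod.distrib[symmetric] enn_powr_mult[symmetric] intro!: prod.cong)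
    also have "\<dots> \<le> (\<integral>\<^sup>+x. (\<Prod>i\<in>I. enn_powr (N i) (a i)) * (\<Sum>i\<in>I. ennreal (a i) * (g i x / N i)) \<partial>M)"
      using assms by (intro nn_integral_mono mult_left_mono enn_weighted_arith_geom_mean) auto
    also have "\<dots> = (\<Prod>i\<in>I. enn_powr (N i) (a i)) * (\<Sum>i\<in>I. ennreal (a i) * (N i / N i))"
      using I by (simp add: nn_integral_cmult nn_integral_sum nn_integral_divide N_def)
    also have "(\<Sum>i\<in>I. ennreal (a i) * (N i / N i)) = (\<Sum>i\<in>I. ennreal (a i))"
      using 3 by (intro sum.cong) (simp_all add: less_le)
    also have "\<dots> = 1"
      using a by (simp add: sum_ennreal less_imp_le)
    finally show ?thesis by (simp add: N_def)
  qed
qed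

lemma nn_integral_Holder:
  fixes f g :: "'a \<Rightarrow> ennreal"
  assumes "0 < a" "a < 1" and [measurable]: "f \<in> borel_measurable M" "g \<in> borel_measurable M"
  shows "(\<integral>\<^sup>+x. enn_powr (f x) a * enn_powr (g x) (1 - a) \<partial>M)
    \<le> enn_powr (\<integral>\<^sup>+x. f x \<partial>M) a * enn_powr (\<integral>\<^sup>+x. g x \<partial>M) (1 - a)"
  using assms nn_integral_Holder_prod[of UNIV "\<lambda>b. if b then a else 1 - a" "\<lambda>b. if b then f else g" M]
  by (simp add: UNIV_bool mult.commute)

subsection \<open>Maximal functions over nested families\<close>

definition maximal_fn :: "'a set set \<Rightarrow> 'a measure \<Rightarrow> ('a \<Rightarrow> ennreal) \<Rightarrow> 'a \<Rightarrow> ennreal" where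
  "maximal_fn D M g x = (SUP B\<in>{B \<in> D. x \<in> B}. (\<integral>\<^sup>+y\<in>B. g y \<partial>M) / emeasure M B)"

definition nested_family :: "'a set set \<Rightarrow> bool" where
  "nested_family D \<longleftrightarrow> (\<forall>A\<in>D. \<forall>B\<in>D. A \<subseteq> B \<or> B \<subseteq> A \<or> A \<inter> B = {})"

lemma maximal_fn_upper:
  "B \<in> D \<Longrightarrow> x \<in> B \<Longrightarrow> (\<integral>\<^sup>+y\<in>B. g y \<partial>M) / emeasure M B \<le> maximal_fn D M g x"
  unfolding maximal_fn_def by (rule SUP_upper) auto

lemma maximal_fn_eq_SUP_indicator:
  "maximal_fn D M g x = (SUP B\<in>D. (\<integral>\<^sup>+y\<in>B. g y \<partial>M) / emeasure M B * indicator B x)"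
  unfolding maximal_fn_def
proof (rule antisym)
  show "(SUP B\<in>{B \<in> D. x \<in> B}. (\<integral>\<^sup>+y\<in>B. g y \<partial>M) / emeasure M B)
      \<le> (SUP B\<in>D. (\<integral>\<^sup>+y\<in>B. g y \<partial>M) / emeasure M B * indicator B x)"
    by (rule SUP_mono) force
  show "(SUP B\<in>D. (\<integral>\<^sup>+y\<in>B. g y \<partial>M) / emeasure M B * indicator B x)
      \<le> (SUP B\<in>{B \<in> D. x \<in> B}. (\<integral>\<^sup>+y\<in>B. g y \<partial>M) / emeasure M B)"
    by (rule SUP_least) (auto simp: indicator_def intro: SUP_upper)
qed

lemma measurable_maximal_fn [measurable]:
  assumes "countable D" "D \<subseteq> sets M"
  shows "maximal_fn D M g \<in> borel_measurable M"
proof -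
  have "(\<lambda>x. SUP B\<in>D. (\<integral>\<^sup>+y\<in>B. g y \<partial>M) / emeasure M B * indicator B x) \<in> borel_measurable M"
    using assms by (intro borel_measurable_SUP borel_measurable_times_ennreal
        borel_measurable_const borel_measurable_indicator) auto
  then show ?thesis
    by (simp add: maximal_fn_eq_SUP_indicator[abs_def])
qed

lemma powr_Young_step:
  fixes a b r :: real
  assumes "1 < r" "0 \<le> a" "0 \<le> b"
  shows "b powr r + conj_exp r * a powr (r - 1) * b \<le> a powr r + conj_exp r * b powr r"
proof -
  have "b * a powr (r - 1) \<le> b powr r / r + (a powr (r - 1)) powr conj_exp r / conj_exp r"
    using assms by (intro Youngs_inequality) (auto simp: conj_exp_def divide_simps)
  also have "(a powr (r - 1)) powr conj_exp r = a powr r"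
    using assms by (simp add: powr_powr conj_exp_def)
  finally have "conj_exp r * (b * a powr (r - 1))
      \<le> conj_exp r * (b powr r / r + a powr r / conj_exp r)"
    using assms by (intro mult_left_mono) (auto simp: conj_exp_def)
  also have "\<dots> = (conj_exp r - 1) * b powr r + a powr r"
    using assms by (simp add: conj_exp_def divide_simps)
  finally show ?thesis
    by (simp add: algebra_simps)
qed

lemma nn_integral_maximal_fn_powr_finite:
  assumes F: "finite F" "F \<subseteq> sets M" and r: "1 < r"
    and pos: "\<And>B. B \<in> F \<Longrightarrow> 0 < emeasure M B" and fin: "\<And>B. B \<in> F \<Longrightarrow> emeasure M B < \<infinity>"
    and int: "\<And>B. B \<in> F \<Longrightarrow> (\<integral>\<^sup>+y\<in>B. g y \<partial>M) < \<infinity>"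
  shows "(\<integral>\<^sup>+x. enn_powr (maximal_fn F M g x) r \<partial>M) < \<infinity>"
proof -
  define c where "c B = (\<integral>\<^sup>+y\<in>B. g y \<partial>M) / emeasure M B" for B
  have c: "c B < \<infinity>" if "B \<in> F" for B
    using pos[OF that] int[OF that] by (auto simp: c_def less_top[symmetric] ennreal_divide_eq_top_iff)
  define K where "K = (\<Sum>B\<in>F. c B)"
  have K: "K < \<infinity>" using c F by (auto simp: K_def less_top[symmetric])
  have U: "emeasure M (\<Union>F) < \<infinity>"
    using F fin by (intro le_less_trans[OF emeasure_subadditive_finite[of F "\<lambda>B. B" M, simplified]])
      (auto simp: less_top[symmetric])
  have "maximal_fn F M g x \<le> K * indicator (\<Union>F) x" for x
    unfolding maximal_fn_def c_def[symmetric] K_def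
    using F by (intro SUP_least) (auto simp: indicator_def intro!: member_le_sum)
  then have "(\<integral>\<^sup>+x. enn_powr (maximal_fn F M g x) r \<partial>M)
      \<le> (\<integral>\<^sup>+x. enn_powr (K * indicator (\<Union>F) x) r \<partial>M)"
    using r by (intro nn_integral_mono enn_powr_mono) auto
  also have "\<dots> = (\<integral>\<^sup>+x. enn_powr K r * indicator (\<Union>F) x \<partial>M)"
    by (intro nn_integral_cong) (auto simp: indicator_def)
  also have "\<dots> = enn_powr K r * emeasure M (\<Union>F)"
    using F by (intro nn_integral_cmult_indicator) auto
  also have "\<dots> < \<infinity>"
    using K U by (simp add: ennreal_mult_less_top enn_powr_less_top)
  finally show ?thesis .
qed

lemma maximal_fn_remove_minimal:
  assumes F: "nested_family F" "Q \<in> F" and min: "\<forall>B\<in>F. B \<subseteq> Q \<longrightarrow> B = Q"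
  shows "x \<notin> Q \<Longrightarrow> maximal_fn (F - {Q}) M g x = maximal_fn F M g x"
    and "x \<in> Q \<Longrightarrow> maximal_fn (F - {Q}) M g x
           = (SUP B\<in>{B \<in> F - {Q}. Q \<subseteq> B}. (\<integral>\<^sup>+y\<in>B. g y \<partial>M) / emeasure M B)"
    and "x \<in> Q \<Longrightarrow> maximal_fn F M g x
           = max ((\<integral>\<^sup>+y\<in>Q. g y \<partial>M) / emeasure M Q) (maximal_fn (F - {Q}) M g x)"
proof -
  assume "x \<notin> Q"
  then have "{B \<in> F - {Q}. x \<in> B} = {B \<in> F. x \<in> B}" by auto
  then show "maximal_fn (F - {Q}) M g x = maximal_fn F M g x"
    by (simp only: maximal_fn_def)
next
  assume x: "x \<in> Q"
  have "Q \<subseteq> B" if B: "B \<in> F" "x \<in> B" for B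
  proof -
    have "B \<subseteq> Q \<or> Q \<subseteq> B \<or> B \<inter> Q = {}"
      using F B(1) by (simp add: nested_family_def)
    then show ?thesis using min B x by auto
  qed
  then have "{B \<in> F - {Q}. x \<in> B} = {B \<in> F - {Q}. Q \<subseteq> B}"
    using x by auto
  then show "maximal_fn (F - {Q}) M g x
           = (SUP B\<in>{B \<in> F - {Q}. Q \<subseteq> B}. (\<integral>\<^sup>+y\<in>B. g y \<partial>M) / emeasure M B)"
    by (simp only: maximal_fn_def)
  have "{B \<in> F. x \<in> B} = insert Q {B \<in> F - {Q}. x \<in> B}"
    using x F by auto
  then show "maximal_fn F M g x
           = max ((\<integral>\<^sup>+y\<in>Q. g y \<partial>M) / emeasure M Q) (maximal_fn (F - {Q}) M g x)"
    by (simp only: maximal_fn_def SUP_insert sup_max)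
qed

lemma nn_integral_split_set:
  assumes [measurable]: "f \<in> borel_measurable M" "A \<in> sets M"
  shows "(\<integral>\<^sup>+x. f x \<partial>M) = (\<integral>\<^sup>+x\<in>-A. f x \<partial>M) + (\<integral>\<^sup>+x\<in>A. f x \<partial>M)"
proof -
  have "(\<integral>\<^sup>+x. f x \<partial>M) = (\<integral>\<^sup>+x. f x * indicator (space M - A) x + f x * indicator A x \<partial>M)"
    by (intro nn_integral_cong) (auto simp: indicator_def)
  also have "\<dots> = (\<integral>\<^sup>+x\<in>space M - A. f x \<partial>M) + (\<integral>\<^sup>+x\<in>A. f x \<partial>M)"
    by (intro nn_integral_add) auto
  also have "(\<integral>\<^sup>+x\<in>space M - A. f x \<partial>M) = (\<integral>\<^sup>+x\<in>-A. f x \<partial>M)"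
    by (intro nn_integral_cong) (auto simp: indicator_def)
  finally show ?thesis .
qed

text \<open>
  Induction on the family: removing a minimal cube only changes the maximal function on that cube,
  where it is constant before and after, and there the claim is Young's inequality.
\<close>
lemma Doob_weak_type_integrated:
  assumes "finite F" "F \<subseteq> sets M" "nested_family F" and r: "1 < r"
    and "\<And>B. B \<in> F \<Longrightarrow> 0 < emeasure M B" and "\<And>B. B \<in> F \<Longrightarrow> emeasure M B < \<infinity>"
    and "\<And>B. B \<in> F \<Longrightarrow> (\<integral>\<^sup>+y\<in>B. g y \<partial>M) < \<infinity>"
    and [measurable]: "g \<in> borel_measurable M"
  shows "(\<integral>\<^sup>+x. enn_powr (maximal_fn F M g x) r \<partial>M)
    \<le> ennreal (conj_exp r) * (\<integral>\<^sup>+x. enn_powr (maximal_fn F M g x) (r - 1) * g x \<partial>M)"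
  using assms(1-3,5-7)
proof (induction rule: finite_psubset_induct)
  case (psubset F)
  show ?case
  proof (cases "F = {}")
    case True
    then show ?thesis by (simp add: maximal_fn_def bot_ennreal)
  next
    case False
    then obtain Q where Q: "Q \<in> F" and min: "\<forall>B\<in>F. B \<subseteq> Q \<longrightarrow> B = Q"
      using finite_has_minimal[OF psubset.hyps(1)] by metis
    define F' where "F' = F - {Q}"
    define c where "c B = (\<integral>\<^sup>+y\<in>B. g y \<partial>M) / emeasure M B" for B
    define a where "a = (SUP B\<in>{B \<in> F'. Q \<subseteq> B}. c B)"
    note rem = maximal_fn_remove_minimal[OF psubset.prems(2) Q min, of _ M g,
        folded F'_def, folded c_def, folded a_def]
    have "nested_family F'" using psubset.prems(2) by (auto simp: nested_family_def F'_def)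
    then have IH: "(\<integral>\<^sup>+x. enn_powr (maximal_fn F' M g x) r \<partial>M)
        \<le> ennreal (conj_exp r) * (\<integral>\<^sup>+x. enn_powr (maximal_fn F' M g x) (r - 1) * g x \<partial>M)"
      using psubset.prems Q by (intro psubset.IH) (auto simp: F'_def)
    have c: "c B < \<infinity>" if "B \<in> F" for B
      using psubset.prems(3,5)[OF that] by (auto simp: c_def less_top[symmetric] ennreal_divide_eq_top_iff)
    have "a \<le> (\<Sum>B\<in>F. c B)"
      using psubset.hyps unfolding a_def by (intro SUP_least) (auto simp: F'_def intro!: member_le_sum)
    also have "\<dots> < \<infinity>" using c psubset.hyps by (auto simp: less_top[symmetric])
    finally have a: "a < \<infinity>" .
    show ?thesis
    proof (cases "c Q \<le> a")
      case True
      have "maximal_fn F M g x = maximal_fn F' M g x" for x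
      proof (cases "x \<in> Q")
        case xQ: True
        show ?thesis using True by (simp only: rem(2,3)[OF xQ] max.absorb2)
      qed (simp add: rem(1))
      then show ?thesis using IH by simp
    next
      case False
      define b m where "b = c Q" and "m = emeasure M Q"
      have m: "0 < m" "m < \<infinity>" using psubset.prems(3,4)[OF Q] by (auto simp: m_def)
      obtain a' where a': "a = ennreal a'" "0 \<le> a'" using a by (cases a) auto
      obtain b' where b': "b = ennreal b'" "0 \<le> b'" using c[OF Q] by (cases "c Q") (auto simp: b_def)
      have G: "(\<integral>\<^sup>+y\<in>Q. g y \<partial>M) = b * m"
        using m by (simp add: b_def c_def m_def[symmetric] ennreal_divide_times)
      have [measurable]: "Q \<in> sets M" using Q psubset.prems(1) by auto
      have [measurable]: "maximal_fn F M g \<in> borel_measurable M" "maximal_fn F' M g \<in> borel_measurable M"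
        using psubset.hyps psubset.prems(1)
        by (auto simp: F'_def intro!: measurable_maximal_fn countable_finite)
      have out: "(\<integral>\<^sup>+x\<in>-Q. enn_powr (maximal_fn F M g x) e * h x \<partial>M)
          = (\<integral>\<^sup>+x\<in>-Q. enn_powr (maximal_fn F' M g x) e * h x \<partial>M)" for e h
        by (intro nn_integral_cong) (auto simp: rem(1) indicator_def)
      have inF: "(\<integral>\<^sup>+x\<in>Q. enn_powr (maximal_fn F M g x) e * h x \<partial>M) = enn_powr b e * (\<integral>\<^sup>+x\<in>Q. h x \<partial>M)"
        if [measurable]: "h \<in> borel_measurable M" for e h
      proof -
        have "(\<integral>\<^sup>+x\<in>Q. enn_powr (maximal_fn F M g x) e * h x \<partial>M) = (\<integral>\<^sup>+x. enn_powr b e * (h x * indicator Q x) \<partial>M)"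
          using False by (intro nn_integral_cong) (auto simp: rem(2,3) indicator_def b_def max_def)
        then show ?thesis by (simp add: nn_integral_cmult)
      qed
      have inF': "(\<integral>\<^sup>+x\<in>Q. enn_powr (maximal_fn F' M g x) e * h x \<partial>M) = enn_powr a e * (\<integral>\<^sup>+x\<in>Q. h x \<partial>M)"
        if [measurable]: "h \<in> borel_measurable M" for e h
      proof -
        have "(\<integral>\<^sup>+x\<in>Q. enn_powr (maximal_fn F' M g x) e * h x \<partial>M) = (\<integral>\<^sup>+x. enn_powr a e * (h x * indicator Q x) \<partial>M)"
          by (intro nn_integral_cong) (auto simp: rem(2) indicator_def)
        then show ?thesis by (simp add: nn_integral_cmult)
      qed
      define X where "X = (\<integral>\<^sup>+x\<in>-Q. enn_powr (maximal_fn F' M g x) r * 1 \<partial>M)"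
      define Y where "Y = (\<integral>\<^sup>+x\<in>-Q. enn_powr (maximal_fn F' M g x) (r - 1) * g x \<partial>M)"
      have L: "(\<integral>\<^sup>+x. enn_powr (maximal_fn F M g x) r \<partial>M) = X + enn_powr b r * m"
        "(\<integral>\<^sup>+x. enn_powr (maximal_fn F' M g x) r \<partial>M) = X + enn_powr a r * m"
        using nn_integral_split_set[of "\<lambda>x. enn_powr (maximal_fn F M g x) r" M Q]
          nn_integral_split_set[of "\<lambda>x. enn_powr (maximal_fn F' M g x) r" M Q]
          out[of r "\<lambda>_. 1"] inF[of "\<lambda>_. 1" r] inF'[of "\<lambda>_. 1" r]
        by (simp_all add: X_def m_def)
      have R: "(\<integral>\<^sup>+x. enn_powr (maximal_fn F M g x) (r - 1) * g x \<partial>M) = Y + enn_powr b (r - 1) * (b * m)"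
        "(\<integral>\<^sup>+x. enn_powr (maximal_fn F' M g x) (r - 1) * g x \<partial>M) = Y + enn_powr a (r - 1) * (b * m)"
        using nn_integral_split_set[of "\<lambda>x. enn_powr (maximal_fn F M g x) (r - 1) * g x" M Q]
          nn_integral_split_set[of "\<lambda>x. enn_powr (maximal_fn F' M g x) (r - 1) * g x" M Q]
        by (simp_all add: Y_def out inF inF' G)
      define k where "k = conj_exp r"
      have k: "0 \<le> k" using r by (simp add: k_def conj_exp_def)
      have bb: "enn_powr b (r - 1) * b = enn_powr b r"
        using enn_powr_add[of b "r - 1" 1] by simp
      have step: "enn_powr b r + ennreal k * enn_powr a (r - 1) * b \<le> enn_powr a r + ennreal k * enn_powr b r"
        using powr_Young_step[OF r a'(2) b'(2)] a' b' k
        by (simp add: enn_powr_ennreal k_def[symmetric] ennreal_mult[symmetric] ennreal_plus[symmetric]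
            ennreal_leI del: ennreal_plus)
      define t where "t = ennreal k * enn_powr a (r - 1) * b * m"
      have t: "t < \<infinity>"
        using a' b' m by (simp add: t_def ennreal_mult_less_top enn_powr_less_top)
      have "(X + enn_powr b r * m) + t = X + (enn_powr b r + ennreal k * enn_powr a (r - 1) * b) * m"
        by (simp add: t_def distrib_right add.assoc)
      also have "\<dots> \<le> X + (enn_powr a r + ennreal k * enn_powr b r) * m"
        by (intro add_left_mono mult_right_mono step) simp
      also have "\<dots> = (X + enn_powr a r * m) + ennreal k * enn_powr b r * m"
        by (simp add: distrib_right add.assoc)
      also have "\<dots> \<le> ennreal k * (Y + enn_powr a (r - 1) * (b * m)) + ennreal k * enn_powr b r * m"
        using IH by (intro add_right_mono) (simp add: L R k_def)
      also have "\<dots> = ennreal k * (Y + enn_powr b (r - 1) * (b * m)) + t"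
        by (simp add: t_def distrib_left bb[symmetric] ac_simps)
      finally show ?thesis
        using t by (simp add: L R k_def ennreal_add_left_cancel_le add.commute[of _ t] less_top[symmetric])
    qed
  qed
qed

lemma ennreal_le_of_le_powr_mult:
  assumes "A \<le> k * (enn_powr A (1 - 1 / r) * enn_powr N (1 / r))" "A < \<infinity>" "1 < r"
  shows "A \<le> enn_powr k r * N"
proof (cases "A = 0")
  case False
  define s where "s = enn_powr A (1 - 1 / r)"
  have s: "s \<noteq> 0" "s \<noteq> top" using False assms by (auto simp: s_def)
  have "s * enn_powr A (1 / r) = A"
    using enn_powr_add[of A "1 - 1 / r" "1 / r"] by (simp add: s_def)
  with assms have "s * enn_powr A (1 / r) \<le> s * (k * enn_powr N (1 / r))"
    by (simp add: s_def ac_simps)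
  then have "enn_powr A (1 / r) \<le> k * enn_powr N (1 / r)"
    using s by (metis ennreal_mult_le_mult_iff)
  from enn_powr_mono[OF _ this, of r] show ?thesis
    using assms by (simp add: enn_powr_mult enn_powr_enn_powr)
qed simp

theorem Doob_maximal_inequality:
  assumes D: "countable D" "D \<subseteq> sets M" "nested_family D" and r: "1 < r"
    and pos: "\<And>B. B \<in> D \<Longrightarrow> 0 < emeasure M B" and fin: "\<And>B. B \<in> D \<Longrightarrow> emeasure M B < \<infinity>"
    and [measurable]: "g \<in> borel_measurable M"
  shows "(\<integral>\<^sup>+x. enn_powr (maximal_fn D M g x) r \<partial>M)
    \<le> enn_powr (ennreal (conj_exp r)) r * (\<integral>\<^sup>+x. enn_powr (g x) r \<partial>M)"
proof (cases "D = {} \<or> (\<integral>\<^sup>+x. enn_powr (g x) r \<partial>M) = \<infinity>")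
  case True
  then show ?thesis
    using r by (auto simp: maximal_fn_def bot_ennreal ennreal_mult_top conj_exp_def)
next
  case False
  then have ne: "D \<noteq> {}" and N: "(\<integral>\<^sup>+x. enn_powr (g x) r \<partial>M) < \<infinity>" by (auto simp: less_top)
  have int: "(\<integral>\<^sup>+y\<in>B. g y \<partial>M) < \<infinity>" if B: "B \<in> D" for B
  proof -
    have [measurable]: "B \<in> sets M" using B D by auto
    have "g x \<le> 1 + enn_powr (g x) r" for x
    proof (cases "g x \<le> 1")
      case False
      then have "enn_powr (g x) 1 * 1 \<le> enn_powr (g x) 1 * enn_powr (g x) (r - 1)"
        using r by (intro mult_left_mono one_le_enn_powr) auto
      then have "g x \<le> enn_powr (g x) r"
        by (simp only: enn_powr_add[symmetric]) simp
      also have "\<dots> \<le> 1 + \<dots>" by simp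
      finally show ?thesis .
    qed (simp add: add_increasing2)
    then have "(\<integral>\<^sup>+y\<in>B. g y \<partial>M) \<le> (\<integral>\<^sup>+x. indicator B x + enn_powr (g x) r \<partial>M)"
      by (intro nn_integral_mono) (auto simp: indicator_def)
    also have "\<dots> = emeasure M B + (\<integral>\<^sup>+x. enn_powr (g x) r \<partial>M)"
      by (simp add: nn_integral_add)
    also have "\<dots> < \<infinity>" using fin[OF B] N by simp
    finally show ?thesis .
  qed
  have finite_case: "(\<integral>\<^sup>+x. enn_powr (maximal_fn F M g x) r \<partial>M)
    \<le> enn_powr (ennreal (conj_exp r)) r * (\<integral>\<^sup>+x. enn_powr (g x) r \<partial>M)" if F: "finite F" "F \<subseteq> D" for F
  proof -
    have F': "F \<subseteq> sets M" "nested_family F"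
      using F(2) D(2,3) unfolding nested_family_def by (simp_all add: subset_iff)
    have [measurable]: "maximal_fn F M g \<in> borel_measurable M"
      using F F' by (intro measurable_maximal_fn countable_finite) auto
    have e: "r * (1 - 1 / r) = r - 1" "1 - (1 - 1 / r) = 1 / r" using r by (auto simp: field_simps)
    have "(\<integral>\<^sup>+x. enn_powr (maximal_fn F M g x) (r - 1) * g x \<partial>M)
       = (\<integral>\<^sup>+x. enn_powr (enn_powr (maximal_fn F M g x) r) (1 - 1 / r)
            * enn_powr (enn_powr (g x) r) (1 - (1 - 1 / r)) \<partial>M)"
      unfolding enn_powr_enn_powr e using r by simp
    also have "\<dots> \<le> enn_powr (\<integral>\<^sup>+x. enn_powr (maximal_fn F M g x) r \<partial>M) (1 - 1 / r)
         * enn_powr (\<integral>\<^sup>+x. enn_powr (g x) r \<partial>M) (1 - (1 - 1 / r))"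
      using r by (intro nn_integral_Holder) auto
    finally have Holder: "(\<integral>\<^sup>+x. enn_powr (maximal_fn F M g x) (r - 1) * g x \<partial>M)
       \<le> enn_powr (\<integral>\<^sup>+x. enn_powr (maximal_fn F M g x) r \<partial>M) (1 - 1 / r)
         * enn_powr (\<integral>\<^sup>+x. enn_powr (g x) r \<partial>M) (1 / r)"
      unfolding e .
    have "(\<integral>\<^sup>+x. enn_powr (maximal_fn F M g x) r \<partial>M)
      \<le> ennreal (conj_exp r) * (\<integral>\<^sup>+x. enn_powr (maximal_fn F M g x) (r - 1) * g x \<partial>M)"
      using F F' pos fin int by (intro Doob_weak_type_integrated r) auto
    also note mult_left_mono[OF Holder zero_le]
    finally show ?thesis
      using r F F' pos fin int
      by (intro ennreal_le_of_le_powr_mult nn_integral_maximal_fn_powr_finite) auto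
  qed
  define F where "F n = from_nat_into D ` {..<n}" for n
  have F: "finite (F n)" "F n \<subseteq> D" for n
    using from_nat_into[OF ne] by (auto simp: F_def)
  have UF: "(\<Union>n. F n) = D"
    by (simp add: F_def image_UN[symmetric] UN_lessThan_UNIV range_from_nat_into[OF ne D(1)])
  have "maximal_fn D M g x = (SUP n. maximal_fn (F n) M g x)" for x
    unfolding maximal_fn_eq_SUP_indicator UF[symmetric] by (simp add: SUP_UNION)
  then have "(\<integral>\<^sup>+x. enn_powr (maximal_fn D M g x) r \<partial>M)
      = (\<integral>\<^sup>+x. (SUP n. enn_powr (maximal_fn (F n) M g x) r) \<partial>M)"
    using r by (simp add: SUP_enn_powr)
  also have "\<dots> = (SUP n. \<integral>\<^sup>+x. enn_powr (maximal_fn (F n) M g x) r \<partial>M)"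
  proof (rule nn_integral_monotone_convergence_SUP)
    have "F m \<subseteq> F n" if "m \<le> n" for m n using that by (auto simp: F_def)
    then show "incseq (\<lambda>n x. enn_powr (maximal_fn (F n) M g x) r)"
      using r unfolding maximal_fn_eq_SUP_indicator
      by (intro incseq_SucI le_funI enn_powr_mono SUP_subset_mono) auto
    show "(\<lambda>x. enn_powr (maximal_fn (F n) M g x) r) \<in> borel_measurable M" for n
      using F D by (intro measurable_enn_powr measurable_maximal_fn countable_finite) auto
  qed
  also have "\<dots> \<le> enn_powr (ennreal (conj_exp r)) r * (\<integral>\<^sup>+x. enn_powr (g x) r \<partial>M)"
    using F by (intro SUP_least finite_case)
  finally show ?thesis .
qed

subsection \<open>Dyadic cubes and weights\<close>

lemma dyadic_cube_floor: "x \<in> dyadic_cube k m \<longleftrightarrow> (\<forall>j. \<lfloor>2 powi k * x $ j\<rfloor> = m $ j)"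
proof -
  have "\<lfloor>2 powi k * y\<rfloor> = i \<longleftrightarrow> 2 powi (- k) * of_int i \<le> y \<and> y < 2 powi (- k) * (of_int i + 1)"
    for y :: real and i
  proof -
    have "(0::real) < 2 powi k" by simp
    then show ?thesis
      by (simp add: floor_eq_iff power_int_minus field_simps)
  qed
  then show ?thesis by (simp add: dyadic_cube_def)
qed

lemma dyadic_gen_unique: "B \<in> dyadic_gen k \<Longrightarrow> B' \<in> dyadic_gen k \<Longrightarrow> x \<in> B \<Longrightarrow> x \<in> B' \<Longrightarrow> B = B'"
  by (auto simp: dyadic_gen_def set_eq_iff dyadic_cube_floor)

lemma floor_powi_div:
  fixes y :: real
  assumes "k \<le> k'"
  shows "\<lfloor>2 powi k * y\<rfloor> = \<lfloor>2 powi k' * y\<rfloor> div 2 ^ nat (k' - k)"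
proof -
  have "(2::real) powi k' = 2 powi k * 2 ^ nat (k' - k)"
    using assms power_int_add[of "2::real" k "k' - k"] by (simp add: power_int_def)
  then have "2 powi k * y = (2 powi k' * y) / real_of_int (2 ^ nat (k' - k))"
    by (simp add: field_simps)
  then show ?thesis
    using floor_divide_real_eq_div[of "2 ^ nat (k' - k)" "2 powi k' * y"] by simp
qed

lemma dyadic_cube_nested:
  assumes "k \<le> k'" "x \<in> dyadic_cube k m" "x \<in> dyadic_cube k' m'"
  shows "dyadic_cube k' m' \<subseteq> dyadic_cube k m"
  using assms by (auto simp: dyadic_cube_floor floor_powi_div[OF assms(1)])

lemma nested_dyadic: "nested_family dyadic"
proof -
  have "A \<subseteq> B \<or> B \<subseteq> A \<or> A \<inter> B = {}" if "A = dyadic_cube k m" "B = dyadic_cube k' m'" for A B and k k' m m'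
  proof (cases "k \<le> k'")
    case True
    then show ?thesis using dyadic_cube_nested[of k k' _ m m'] that by auto
  next
    case False
    then have "k' \<le> k" by simp
    then show ?thesis using dyadic_cube_nested[of k' k _ m' m] that by auto
  qed
  then show ?thesis
    unfolding nested_family_def dyadic_def dyadic_gen_def by blast
qed

lemma countable_dyadic: "countable dyadic"
  by (auto simp: dyadic_def dyadic_gen_def)

lemma sets_dyadic:
  fixes B :: "(real ^ 'n) set"
  assumes "B \<in> dyadic" shows "B \<in> sets lebesgue"
proof -
  have "dyadic_cube k m \<in> sets (borel :: (real ^ 'n) measure)" for k m
    unfolding dyadic_cube_def by measurable
  then show ?thesis using assms by (auto simp: dyadic_def dyadic_gen_def)
qed

lemma dyadic_bounds:
  fixes B :: "(real ^ 'n) set"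
  assumes "B \<in> dyadic"
  obtains a b where "box a b \<noteq> {}" "box a b \<subseteq> B" "B \<subseteq> cbox a b"
proof -
  obtain k m where B: "B = dyadic_cube k m" using assms by (auto simp: dyadic_def dyadic_gen_def)
  define a b :: "real ^ 'n" where "a = (\<chi> j. 2 powi (- k) * of_int (m $ j))"
    and "b = (\<chi> j. 2 powi (- k) * (of_int (m $ j) + 1))"
  have ab: "a $ j < b $ j" for j by (simp add: a_def b_def)
  have "(\<chi> j. (a $ j + b $ j) / 2) \<in> box a b"
    using ab by (auto simp: mem_box_cart field_simps)
  then have "box a b \<noteq> {}" by auto
  moreover have "box a b \<subseteq> B" "B \<subseteq> cbox a b"
    by (simp_all add: subset_iff B dyadic_cube_def mem_box_cart a_def b_def less_imp_le)
  ultimately show thesis by (rule that)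
qed

lemma emeasure_dyadic:
  fixes B :: "(real ^ 'n) set"
  assumes "B \<in> dyadic"
  shows "0 < emeasure lebesgue B" "emeasure lebesgue B < \<infinity>"
proof -
  obtain a b where ab: "box a b \<noteq> {}" "box a b \<subseteq> B" "B \<subseteq> cbox a b"
    using dyadic_bounds[OF assms] .
  have "emeasure lebesgue (box a b) \<noteq> 0"
    using open_not_negligible[OF open_box ab(1)] by (auto simp: negligible_iff_null_sets null_sets_def)
  moreover have "emeasure lebesgue (box a b) \<le> emeasure lebesgue B"
    using ab assms sets_dyadic by (intro emeasure_mono) auto
  ultimately show "0 < emeasure lebesgue B" by (metis gr_zeroI le_zero_eq)
  have "emeasure lebesgue B \<le> emeasure lebesgue (cbox a b)"
    using ab by (intro emeasure_mono) auto
  also have "\<dots> < \<infinity>" by (simp add: emeasure_lborel_cbox_eq)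
  finally show "emeasure lebesgue B < \<infinity>" .
qed

lemma nn_integral_dyadic_pos:
  fixes B :: "(real ^ 'n) set"
  assumes "B \<in> dyadic" and [measurable]: "f \<in> borel_measurable lebesgue" and "AE x in lebesgue. 0 < f x"
  shows "0 < (\<integral>\<^sup>+x\<in>B. f x \<partial>lebesgue)"
proof (rule ccontr)
  have [measurable]: "B \<in> sets lebesgue" using assms sets_dyadic by auto
  assume "\<not> ?thesis"
  then have "AE x in lebesgue. f x * indicator B x = 0"
    by (subst nn_integral_0_iff_AE[symmetric]) auto
  with assms(3) have "AE x in lebesgue. x \<notin> B"
    by eventually_elim (auto simp: indicator_def split: if_splits)
  then have "emeasure lebesgue B = 0"
    using AE_iff_measurable[of B lebesgue "\<lambda>x. x \<notin> B"] by simp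
  with emeasure_dyadic[OF assms(1)] show False by simp
qed

lemma weight_dyadic:
  fixes B :: "(real ^ 'n) set"
  assumes w: "weight w" and B: "B \<in> dyadic"
  shows "0 < (\<integral>\<^sup>+x\<in>B. ennreal (w x) \<partial>lebesgue)" "(\<integral>\<^sup>+x\<in>B. ennreal (w x) \<partial>lebesgue) < \<infinity>"
proof -
  have [measurable]: "w \<in> borel_measurable lebesgue" and pos: "AE x in lebesgue. 0 < w x"
    using w by (auto simp: weight_def)
  show "0 < (\<integral>\<^sup>+x\<in>B. ennreal (w x) \<partial>lebesgue)"
    using B pos by (intro nn_integral_dyadic_pos) auto
  obtain a b where ab: "B \<subseteq> cbox a b" using dyadic_bounds[OF B] by metis
  have "set_integrable lebesgue (cbox a b) w" using w by (auto simp: weight_def)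
  then have "integrable lebesgue (\<lambda>x. indicator (cbox a b) x * w x)"
    by (simp add: set_integrable_def)
  then have fin: "(\<integral>\<^sup>+x. ennreal \<bar>indicator (cbox a b) x * w x\<bar> \<partial>lebesgue) < \<infinity>"
    by (simp add: integrable_iff_bounded)
  have "(\<integral>\<^sup>+x\<in>B. ennreal (w x) \<partial>lebesgue) \<le> (\<integral>\<^sup>+x. ennreal \<bar>indicator (cbox a b) x * w x\<bar> \<partial>lebesgue)"
    using ab by (intro nn_integral_mono) (auto simp: indicator_def intro!: ennreal_leI)
  with fin show "(\<integral>\<^sup>+x\<in>B. ennreal (w x) \<partial>lebesgue) < \<infinity>" by simp
qed

lemma dual_weight_measurable [measurable]:
  assumes [measurable]: "w \<in> borel_measurable M" shows "dual_weight q w \<in> borel_measurable M"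
  unfolding dual_weight_def[abs_def] by measurable

lemma avg_pos_finite:
  assumes B: "B \<in> dyadic"
  shows "0 < avg B f \<longleftrightarrow> 0 < (\<integral>\<^sup>+x\<in>B. f x \<partial>lebesgue)"
    and "avg B f < \<infinity> \<longleftrightarrow> (\<integral>\<^sup>+x\<in>B. f x \<partial>lebesgue) < \<infinity>"
  using emeasure_dyadic[OF B]
  by (auto simp: avg_def ennreal_zero_less_divide less_top[symmetric] ennreal_divide_eq_top_iff)

lemma dual_weight_pos: "0 < w x \<Longrightarrow> 0 < dual_weight q w x"
  by (simp add: dual_weight_def)

lemma dual_weight_dyadic:
  assumes w: "weight w" and A: "A_const q w < \<infinity>" and q: "1 < q" and B: "B \<in> dyadic"
  shows "0 < (\<integral>\<^sup>+x\<in>B. ennreal (dual_weight q w x) \<partial>lebesgue)"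
    and "(\<integral>\<^sup>+x\<in>B. ennreal (dual_weight q w x) \<partial>lebesgue) < \<infinity>"
proof -
  have [measurable]: "w \<in> borel_measurable lebesgue" and pos: "AE x in lebesgue. 0 < w x"
    using w by (auto simp: weight_def)
  have "AE x in lebesgue. 0 < dual_weight q w x"
    using pos by eventually_elim (simp add: dual_weight_pos)
  then show "0 < (\<integral>\<^sup>+x\<in>B. ennreal (dual_weight q w x) \<partial>lebesgue)"
    using B by (intro nn_integral_dyadic_pos) auto
  have "avg B (\<lambda>x. ennreal (w x)) * enn_powr (avg B (\<lambda>x. ennreal (dual_weight q w x))) (q - 1) \<le> A_const q w"
    unfolding A_const_def using B by (rule SUP_upper)
  also note A
  finally have "avg B (\<lambda>x. ennreal (w x)) * enn_powr (avg B (\<lambda>x. ennreal (dual_weight q w x))) (q - 1) < \<infinity>" .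
  moreover have "0 < avg B (\<lambda>x. ennreal (w x))"
    using weight_dyadic[OF w B] avg_pos_finite[OF B] by metis
  ultimately have "avg B (\<lambda>x. ennreal (dual_weight q w x)) < \<infinity>"
    by (auto simp: less_top[symmetric] ennreal_mult_eq_top_iff)
  then show "(\<integral>\<^sup>+x\<in>B. ennreal (dual_weight q w x) \<partial>lebesgue) < \<infinity>"
    using avg_pos_finite[OF B] by metis
qed

lemma conj_exp_gt_1: "1 < q \<Longrightarrow> 1 < conj_exp q"
  by (simp add: conj_exp_def)

lemma conj_exp_conj_exp: "1 < q \<Longrightarrow> conj_exp (conj_exp q) = q"
  by (simp add: conj_exp_def divide_simps)

lemma weighted_Doob:
  fixes w :: "real ^ 'n \<Rightarrow> real" and g :: "real ^ 'n \<Rightarrow> ennreal"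
  assumes [measurable]: "w \<in> borel_measurable lebesgue" "g \<in> borel_measurable lebesgue"
    and w: "\<And>B. B \<in> dyadic \<Longrightarrow> 0 < (\<integral>\<^sup>+x\<in>B. ennreal (w x) \<partial>lebesgue)"
      "\<And>B. B \<in> dyadic \<Longrightarrow> (\<integral>\<^sup>+x\<in>B. ennreal (w x) \<partial>lebesgue) < \<infinity>"
    and r: "1 < r"
  shows "(\<integral>\<^sup>+x. ennreal (w x) * enn_powr (maximal_fn dyadic (density lebesgue w) g x) r \<partial>lebesgue)
    \<le> enn_powr (ennreal (conj_exp r)) r * (\<integral>\<^sup>+x. ennreal (w x) * enn_powr (g x) r \<partial>lebesgue)"
proof -
  define M where "M = density lebesgue w"
  have sets [simp]: "sets M = sets lebesgue" by (simp add: M_def)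
  have D: "(dyadic :: (real ^ 'n) set set) \<subseteq> sets M" using sets_dyadic by auto
  have [measurable]: "g \<in> borel_measurable M" by (simp add: M_def)
  have e: "emeasure M B = (\<integral>\<^sup>+x\<in>B. ennreal (w x) \<partial>lebesgue)" if "B \<in> dyadic" for B
    using that D by (auto simp: M_def emeasure_density)
  have "(\<integral>\<^sup>+x. enn_powr (maximal_fn dyadic M g x) r \<partial>M)
      \<le> enn_powr (ennreal (conj_exp r)) r * (\<integral>\<^sup>+x. enn_powr (g x) r \<partial>M)"
    using w by (intro Doob_maximal_inequality countable_dyadic nested_dyadic r D)
      (use w in \<open>auto simp: e simp flip: M_def\<close>)
  moreover have "maximal_fn dyadic M g \<in> borel_measurable lebesgue"
    using measurable_maximal_fn[OF countable_dyadic D] by (simp add: M_def)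
  ultimately show ?thesis
    by (simp add: M_def nn_integral_density)
qed

subsection \<open>The dyadic maximal function on a weighted space\<close>

lemma avg_le_maximal_fn:
  "B \<in> dyadic \<Longrightarrow> x \<in> B \<Longrightarrow> avg B f \<le> maximal_fn dyadic lebesgue f x"
  unfolding avg_def by (rule maximal_fn_upper)

lemma maximal_fn_dyadic_eq: "maximal_fn dyadic lebesgue f x = (SUP B\<in>{B \<in> dyadic. x \<in> B}. avg B f)"
  by (simp add: maximal_fn_def avg_def)

lemma set_nn_integral_density:
  assumes [measurable]: "s \<in> borel_measurable M" "g \<in> borel_measurable M" "B \<in> sets M"
    and "AE x in M. s x * g x = f x"
  shows "(\<integral>\<^sup>+x\<in>B. g x \<partial>density M s) = (\<integral>\<^sup>+x\<in>B. f x \<partial>M)"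
proof -
  have "(\<integral>\<^sup>+x\<in>B. g x \<partial>density M s) = (\<integral>\<^sup>+x. s x * (g x * indicator B x) \<partial>M)"
    by (intro nn_integral_density) auto
  also have "\<dots> = (\<integral>\<^sup>+x\<in>B. f x \<partial>M)"
    using assms(4) by (intro nn_integral_cong_AE) (auto elim!: eventually_mono simp: mult.assoc[symmetric])
  finally show ?thesis .
qed

lemma maximal_fn_le_iterated:
  fixes w :: "real ^ 'n \<Rightarrow> real" and f :: "real ^ 'n \<Rightarrow> ennreal"
  assumes w: "weight w" and q: "1 < q" and A: "A_const q w < \<infinity>"
    and [measurable]: "f \<in> borel_measurable lebesgue"
  defines "s \<equiv> dual_weight q w"
  defines "g \<equiv> \<lambda>x. f x * ennreal (w x powr (1 / (q - 1)))"
  defines "h \<equiv> \<lambda>x. enn_powr (maximal_fn dyadic (density lebesgue s) g x) (q - 1) * ennreal (w x powr (- 1))"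
  shows "maximal_fn dyadic lebesgue f x
    \<le> enn_powr (A_const q w * maximal_fn dyadic (density lebesgue w) h x) (1 / (q - 1))"
  unfolding maximal_fn_dyadic_eq[of f]
proof (rule SUP_least, safe)
  fix B :: "(real ^ 'n) set" assume B: "B \<in> dyadic" and x: "x \<in> B"
  note [measurable] = sets_dyadic[OF B]
  have [measurable]: "w \<in> borel_measurable lebesgue" and pos: "AE x in lebesgue. 0 < w x"
    using w by (auto simp: weight_def)
  have [measurable]: "s \<in> borel_measurable lebesgue" "g \<in> borel_measurable lebesgue"
    by (auto simp: s_def g_def)
  define Ms where "Ms = maximal_fn dyadic (density lebesgue s) g"
  have [measurable]: "Ms \<in> borel_measurable lebesgue"
    using measurable_maximal_fn[OF countable_dyadic, of "density lebesgue s" g] sets_dyadic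
    by (auto simp: Ms_def)
  have [measurable]: "h \<in> borel_measurable lebesgue" by (simp add: h_def Ms_def[symmetric])
  define b S W F where "b = emeasure lebesgue B"
    and "S = (\<integral>\<^sup>+x\<in>B. ennreal (s x) \<partial>lebesgue)"
    and "W = (\<integral>\<^sup>+x\<in>B. ennreal (w x) \<partial>lebesgue)"
    and "F = (\<integral>\<^sup>+x\<in>B. f x \<partial>lebesgue)"
  have b: "b \<noteq> 0" "b \<noteq> \<infinity>" using emeasure_dyadic[OF B] by (auto simp: b_def)
  have S: "S \<noteq> 0" "S \<noteq> \<infinity>" using dual_weight_dyadic[OF w A q B] by (auto simp: S_def s_def)
  have W: "W \<noteq> 0" "W \<noteq> \<infinity>" using weight_dyadic[OF w B] by (auto simp: W_def)
  have eS: "emeasure (density lebesgue s) B = S" by (simp add: S_def emeasure_density)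
  have eW: "emeasure (density lebesgue w) B = W" by (simp add: W_def emeasure_density)
  have "(\<integral>\<^sup>+x\<in>B. g x \<partial>density lebesgue s) = F"
    unfolding F_def
  proof (rule set_nn_integral_density)
    show "AE x in lebesgue. ennreal (s x) * g x = f x"
      using pos by eventually_elim
        (simp add: s_def g_def dual_weight_def mult.left_commute[of _ "f _"] ennreal_mult[symmetric]
          powr_add[symmetric])
  qed auto
  then have Ms: "F / S \<le> Ms y" if "y \<in> B" for y
    using maximal_fn_upper[OF B that, of "density lebesgue s" g] by (simp add: Ms_def eS)
  have "(\<integral>\<^sup>+y\<in>B. h y \<partial>density lebesgue w) = (\<integral>\<^sup>+y\<in>B. enn_powr (Ms y) (q - 1) \<partial>lebesgue)"
  proof (rule set_nn_integral_density)
    show "AE y in lebesgue. ennreal (w y) * h y = enn_powr (Ms y) (q - 1)"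
      using pos by eventually_elim
        (simp add: h_def Ms_def[symmetric] mult.left_commute[of _ "enn_powr _ _"] ennreal_mult[symmetric]
          powr_minus divide_simps)
  qed auto
  also have "\<dots> \<ge> (\<integral>\<^sup>+y\<in>B. enn_powr (F / S) (q - 1) \<partial>lebesgue)"
    using Ms q by (intro nn_integral_mono) (auto simp: indicator_def intro!: enn_powr_mono)
  finally have h_ge: "enn_powr (F / S) (q - 1) * b \<le> (\<integral>\<^sup>+y\<in>B. h y \<partial>density lebesgue w)"
    by (simp add: nn_integral_cmult_indicator b_def)
  have A_ge: "W / b * enn_powr (S / b) (q - 1) \<le> A_const q w"
    unfolding A_const_def using B
    by (intro SUP_upper2[of B]) (auto simp: avg_def W_def S_def b_def s_def)
  have eq: "S / b * (F / S) = F / b" "W / b * (b / W) = 1"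
    using b S W by (cases b; cases S; cases W; cases F;
      auto simp: ennreal_top_divide divide_ennreal ennreal_mult[symmetric] ennreal_mult_top)+
  have "enn_powr (F / b) (q - 1) = enn_powr (S / b) (q - 1) * enn_powr (F / S) (q - 1) * (W / b * (b / W))"
    using eq by (simp add: enn_powr_mult[symmetric])
  also have "\<dots> = (W / b * enn_powr (S / b) (q - 1)) * (enn_powr (F / S) (q - 1) * b / W)"
    by (simp add: ac_simps divide_ennreal_def)
  also have "\<dots> \<le> A_const q w * ((\<integral>\<^sup>+y\<in>B. h y \<partial>density lebesgue w) / W)"
    by (intro mult_mono A_ge divide_right_mono_ennreal h_ge) auto
  also have "\<dots> \<le> A_const q w * maximal_fn dyadic (density lebesgue w) h x"
    using maximal_fn_upper[OF B x, of "density lebesgue w" h] by (intro mult_left_mono) (auto simp: eW)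
  finally have "enn_powr (F / b) (q - 1) \<le> A_const q w * maximal_fn dyadic (density lebesgue w) h x" .
  from enn_powr_mono[OF _ this, of "1 / (q - 1)"] q
  show "avg B f \<le> enn_powr (A_const q w * maximal_fn dyadic (density lebesgue w) h x) (1 / (q - 1))"
    by (simp add: enn_powr_enn_powr avg_def F_def b_def)
qed

definition Buckley_const :: "real \<Rightarrow> (real ^ 'n \<Rightarrow> real) \<Rightarrow> ennreal" where
  "Buckley_const q w = enn_powr (A_const q w) (conj_exp q / q) * ennreal (q powr (conj_exp q / q))
     * ennreal (conj_exp q)"

theorem maximal_fn_weighted_bound:
  fixes w :: "real ^ 'n \<Rightarrow> real" and f :: "real ^ 'n \<Rightarrow> ennreal"
  assumes w: "weight w" and q: "1 < q" and A: "A_const q w < \<infinity>"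
    and [measurable]: "f \<in> borel_measurable lebesgue"
  shows "(\<integral>\<^sup>+x. enn_powr (maximal_fn dyadic lebesgue f x) q * ennreal (w x) \<partial>lebesgue)
    \<le> enn_powr (Buckley_const q w) q * (\<integral>\<^sup>+x. enn_powr (f x) q * ennreal (w x) \<partial>lebesgue)"
proof -
  have [measurable]: "w \<in> borel_measurable lebesgue" and pos: "AE x in lebesgue. 0 < w x"
    using w by (auto simp: weight_def)
  define q' where "q' = conj_exp q"
  have q': "1 < q'" "conj_exp q' = q" using q by (auto simp: q'_def conj_exp_gt_1 conj_exp_conj_exp)
  have qq: "1 / (q - 1) * q = q'" "(q - 1) * q' = q" "q' / q * q = q'"
    using q by (auto simp: q'_def conj_exp_def)
  define s where "s = dual_weight q w"
  define g where "g = (\<lambda>x. f x * ennreal (w x powr (1 / (q - 1))))"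
  define Ms where "Ms = maximal_fn dyadic (density lebesgue s) g"
  define h where "h = (\<lambda>x. enn_powr (Ms x) (q - 1) * ennreal (w x powr (- 1)))"
  define Mw where "Mw = maximal_fn dyadic (density lebesgue w) h"
  have [measurable]: "s \<in> borel_measurable lebesgue" "g \<in> borel_measurable lebesgue"
    by (auto simp: s_def g_def)
  have [measurable]: "Ms \<in> borel_measurable lebesgue" "Mw \<in> borel_measurable lebesgue"
    using measurable_maximal_fn[OF countable_dyadic, of "density lebesgue s" g]
      measurable_maximal_fn[OF countable_dyadic, of "density lebesgue w" h] sets_dyadic
    by (auto simp: Ms_def Mw_def)
  have [measurable]: "h \<in> borel_measurable lebesgue" by (simp add: h_def)
  have "(\<integral>\<^sup>+x. enn_powr (maximal_fn dyadic lebesgue f x) q * ennreal (w x) \<partial>lebesgue)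
      \<le> (\<integral>\<^sup>+x. enn_powr (A_const q w) q' * (ennreal (w x) * enn_powr (Mw x) q') \<partial>lebesgue)"
  proof (intro nn_integral_mono)
    fix x
    have "enn_powr (maximal_fn dyadic lebesgue f x) q
        \<le> enn_powr (enn_powr (A_const q w * Mw x) (1 / (q - 1))) q"
      using q maximal_fn_le_iterated[OF w q A, of f x]
      by (intro enn_powr_mono) (simp_all add: Mw_def h_def Ms_def g_def s_def)
    also have "\<dots> = enn_powr (A_const q w) q' * enn_powr (Mw x) q'"
      by (simp only: enn_powr_enn_powr qq enn_powr_mult)
    finally have "enn_powr (maximal_fn dyadic lebesgue f x) q * ennreal (w x)
        \<le> enn_powr (A_const q w) q' * enn_powr (Mw x) q' * ennreal (w x)"
      by (rule mult_right_mono) simp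
    then show "enn_powr (maximal_fn dyadic lebesgue f x) q * ennreal (w x)
        \<le> enn_powr (A_const q w) q' * (ennreal (w x) * enn_powr (Mw x) q')"
      by (simp only: ac_simps)
  qed
  also have "\<dots> = enn_powr (A_const q w) q' * (\<integral>\<^sup>+x. ennreal (w x) * enn_powr (Mw x) q' \<partial>lebesgue)"
    by (rule nn_integral_cmult) simp
  also have "\<dots> \<le> enn_powr (A_const q w) q' * (enn_powr (ennreal q) q' *
      (\<integral>\<^sup>+x. ennreal (w x) * enn_powr (h x) q' \<partial>lebesgue))"
    using weighted_Doob[of w h q'] q' weight_dyadic[OF w]
    by (intro mult_left_mono) (auto simp: Mw_def)
  also have "(\<integral>\<^sup>+x. ennreal (w x) * enn_powr (h x) q' \<partial>lebesgue)
      = (\<integral>\<^sup>+x. ennreal (s x) * enn_powr (Ms x) q \<partial>lebesgue)"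
  proof (intro nn_integral_cong_AE, use pos in eventually_elim)
    fix x assume x: "0 < w x"
    have "w x powr 1 * w x powr (- q') = s x"
      unfolding s_def dual_weight_def powr_add[symmetric] q'_def conj_exp_def
      using q by (intro arg_cong[of _ _ "\<lambda>a. w x powr a"]) (simp add: field_simps)
    then have "w x * w x powr (- q') = s x" using x by simp
    moreover have "enn_powr (h x) q' = enn_powr (Ms x) q * ennreal (w x powr (- q'))"
      by (simp only: h_def enn_powr_mult enn_powr_enn_powr qq enn_powr_ennreal[OF powr_ge_zero] powr_powr)
        simp
    ultimately show "ennreal (w x) * enn_powr (h x) q' = ennreal (s x) * enn_powr (Ms x) q"
      using x ennreal_mult[of "w x" "w x powr (- q')"] by (simp add: ac_simps)
  qed
  also have "\<dots> \<le> enn_powr (ennreal q') q * (\<integral>\<^sup>+x. ennreal (s x) * enn_powr (g x) q \<partial>lebesgue)"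
    using weighted_Doob[of s g q] q dual_weight_dyadic[OF w A q]
    by (auto simp: Ms_def q'_def s_def)
  also have "(\<integral>\<^sup>+x. ennreal (s x) * enn_powr (g x) q \<partial>lebesgue)
      = (\<integral>\<^sup>+x. enn_powr (f x) q * ennreal (w x) \<partial>lebesgue)"
  proof (intro nn_integral_cong_AE, use pos in eventually_elim)
    fix x assume x: "0 < w x"
    have "- 1 / (q - 1) + 1 / (q - 1) * q = (q - 1) / (q - 1)"
      by (simp only: times_divide_eq_left add_divide_distrib[symmetric]) simp
    then have "s x * w x powr (1 / (q - 1) * q) = w x powr 1"
      unfolding s_def dual_weight_def powr_add[symmetric] using q by simp
    then have "s x * w x powr (1 / (q - 1) * q) = w x" using x by simp
    then show "ennreal (s x) * enn_powr (g x) q = enn_powr (f x) q * ennreal (w x)"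
      using x by (simp add: g_def enn_powr_mult enn_powr_ennreal powr_powr s_def dual_weight_def
        mult.left_commute[of _ "enn_powr _ _"] ennreal_mult[symmetric])
  qed
  finally have *: "(\<integral>\<^sup>+x. enn_powr (maximal_fn dyadic lebesgue f x) q * ennreal (w x) \<partial>lebesgue)
    \<le> enn_powr (A_const q w) q' * (enn_powr (ennreal q) q' * (enn_powr (ennreal q') q *
       (\<integral>\<^sup>+x. enn_powr (f x) q * ennreal (w x) \<partial>lebesgue)))"
    by (simp add: mult_left_mono)
  have "enn_powr (Buckley_const q w) q = enn_powr (A_const q w) q' * enn_powr (ennreal q) q' * enn_powr (ennreal q') q"
    using q q' unfolding Buckley_const_def q'_def[symmetric] enn_powr_mult
    by (simp add: enn_powr_enn_powr enn_powr_ennreal powr_powr)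
  with * show ?thesis by (simp add: mult.assoc)
qed

subsection \<open>Infinite products\<close>

lemma inf_prod_LIMSEQ: "inf_prod_conv c \<Longrightarrow> (\<lambda>n. \<Prod>i<n. c i) \<longlonglongrightarrow> inf_prod c"
  by (simp add: inf_prod_conv_def inf_prod_def convergent_LIMSEQ_iff)

lemma LIMSEQ_one_le_prod:
  assumes "\<And>i. 1 \<le> c i"
  shows "(\<lambda>n. \<Prod>i<n. c i) \<longlonglongrightarrow> inf_prod c" "1 \<le> inf_prod c"
proof -
  have inc: "incseq (\<lambda>n. \<Prod>i<n. c i)"
    using assms by (intro incseq_SucI) (metis lessThan_Suc_eq_insert_0 mult.right_neutral mult_left_mono prod.lessThan_Suc zero_le)
  then have "inf_prod_conv c"
    unfolding inf_prod_conv_def by (metis LIMSEQ_SUP convergentI)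
  then show lim: "(\<lambda>n. \<Prod>i<n. c i) \<longlonglongrightarrow> inf_prod c"
    by (rule inf_prod_LIMSEQ)
  show "1 \<le> inf_prod c"
    using incseq_le[OF inc lim, of 0] by simp
qed

lemma inf_prod_dominated:
  assumes le: "\<And>i. c i \<le> d i" and d: "(\<lambda>n. \<Prod>i<n. d i) \<longlonglongrightarrow> D" and fin: "D < \<infinity>"
  shows "inf_prod_conv c" "inf_prod c \<le> D"
proof -
  have le_prod: "(\<Prod>i<n. c i) \<le> (\<Prod>i<n. d i)" for n
    by (intro prod_mono_ennreal le)
  show conv: "inf_prod_conv c"
  proof (cases "D = 0")
    case True
    have "(\<lambda>n. \<Prod>i<n. c i) \<longlonglongrightarrow> 0"
      by (rule tendsto_sandwich[of "\<lambda>_. 0" _ _ "\<lambda>n. \<Prod>i<n. d i"]) (use le_prod d True in auto)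
    then show ?thesis unfolding inf_prod_conv_def by (rule convergentI)
  next
    case False
    have nz: "d i \<noteq> 0" for i
    proof
      assume i: "d i = 0"
      have "\<forall>\<^sub>F n in sequentially. (\<Prod>i<n. d i) = 0"
        using eventually_gt_at_top[of i] by eventually_elim (use i in \<open>auto intro!: prod_zero\<close>)
      then have "(\<lambda>n. \<Prod>i<n. d i) \<longlonglongrightarrow> 0" by (simp add: tendsto_eventually)
      then show False using d False LIMSEQ_unique by blast
    qed
    have nt: "d i \<noteq> top" for i
    proof
      assume i: "d i = top"
      have "\<forall>\<^sub>F n in sequentially. (\<Prod>i<n. d i) = top"
        using eventually_gt_at_top[of i] by eventually_elim (use nz i in \<open>auto simp: ennreal_prod_eq_top\<close>)
      then have "(\<lambda>n. \<Prod>i<n. d i) \<longlonglongrightarrow> top" by (simp add: tendsto_eventually)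
      then show False using d fin LIMSEQ_unique by fastforce
    qed
    have q: "c i = c i / d i * d i" for i
      using nz[of i] nt[of i] by (metis mult_divide_eq_ennreal ennreal_divide_times ennreal_times_divide mult.commute)
    have q1: "c i / d i \<le> 1" for i
      using le[of i] nz[of i] nt[of i] by (intro divide_le_posI_ennreal) (auto simp: zero_less_iff_neq_zero)
    have "decseq (\<lambda>n. \<Prod>i<n. c i / d i)"
      using q1 by (intro decseq_SucI) (metis mult.right_neutral mult_left_mono prod.lessThan_Suc zero_le)
    then obtain E where E: "(\<lambda>n. \<Prod>i<n. c i / d i) \<longlonglongrightarrow> E" "E \<le> 1"
      using LIMSEQ_INF decseq_ge[OF _ LIMSEQ_INF, of "\<lambda>n. \<Prod>i<n. c i / d i" 0]
      by (metis lessThan_0 prod.empty)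
    have "(\<lambda>n. (\<Prod>i<n. c i / d i) * (\<Prod>i<n. d i)) \<longlonglongrightarrow> E * D"
      using E d fin by (intro tendsto_mult_ennreal) (auto simp: top_unique)
    then have "(\<lambda>n. \<Prod>i<n. c i) \<longlonglongrightarrow> E * D"
      by (simp only: prod.distrib[symmetric] q[symmetric])
    then show ?thesis unfolding inf_prod_conv_def by (rule convergentI)
  qed
  show "inf_prod c \<le> D"
    by (intro LIMSEQ_le[OF inf_prod_LIMSEQ[OF conv] d] exI allI impI le_prod)
qed

lemma tendsto_enn_powr_exponent:
  assumes "0 < x" "x < \<infinity>" "(e \<longlongrightarrow> l) F"
  shows "((\<lambda>n. enn_powr x (e n)) \<longlongrightarrow> enn_powr x l) F"
proof -
  obtain r where r: "x = ennreal r" "0 < r"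
    using assms by (cases x) auto
  show ?thesis
    using r assms(3) by (auto simp: enn_powr_ennreal intro!: tendsto_intros)
qed

lemma enn_powr_sum:
  assumes "0 < x" "x < \<infinity>"
  shows "enn_powr x (\<Sum>i\<in>I. e i) = (\<Prod>i\<in>I. enn_powr x (e i))"
proof -
  obtain r where r: "x = ennreal r" "0 < r"
    using assms by (cases x) auto
  have "enn_powr x 0 = 1" using r by (simp add: enn_powr_ennreal)
  then show ?thesis
    by (induction I rule: infinite_finite_induct) (auto simp: enn_powr_add)
qed

lemma liminf_mult_le:
  fixes a b :: "nat \<Rightarrow> ennreal"
  assumes b: "b \<longlonglongrightarrow> l"
  shows "liminf a * l \<le> liminf (\<lambda>n. a n * b n)"
proof -
  have "(INF k\<in>{m..}. a k) * l \<le> liminf (\<lambda>n. a n * b n)" for m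
  proof (cases "l = 0")
    case False
    define c where "c = (INF k\<in>{m..}. a k)"
    have "(\<lambda>n. c * b n) \<longlonglongrightarrow> c * l"
    proof (cases "c = 0")
      assume "c \<noteq> 0"
      with False show ?thesis by (intro tendsto_mult_ennreal[OF tendsto_const b]) simp
    qed simp
    then have "c * l = liminf (\<lambda>n. c * b n)"
      by (simp add: lim_imp_Liminf)
    also have "\<dots> \<le> liminf (\<lambda>n. a n * b n)"
      using eventually_ge_at_top[of m]
      by (intro Liminf_mono, eventually_elim) (auto simp: c_def intro!: mult_right_mono INF_lower)
    finally show ?thesis by (simp add: c_def)
  qed simp
  then show ?thesis
    unfolding liminf_SUP_INF[of a] SUP_mult_right_ennreal by (intro SUP_least)
qed

text \<open>
  The first \<open>n\<close> exponents do not add up to 1. On a set of finite measure the missing exponent is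
  put on the indicator of the set, whose contribution tends to 1.
\<close>
theorem nn_integral_Holder_infinite_prod:
  fixes u :: "nat \<Rightarrow> 'a \<Rightarrow> ennreal"
  assumes "sigma_finite_measure M" and a: "\<And>i. 0 < a i" "a sums 1"
    and [measurable]: "\<And>i. u i \<in> borel_measurable M"
    and K: "\<And>n. (\<Prod>i<n. enn_powr (\<integral>\<^sup>+x. u i x \<partial>M) (a i)) \<le> K n" and L: "K \<longlonglongrightarrow> L"
  shows "(\<integral>\<^sup>+x. liminf (\<lambda>n. \<Prod>i<n. enn_powr (u i x) (a i)) \<partial>M) \<le> L"
proof -
  interpret sigma_finite_measure M by fact
  define F where "F x = liminf (\<lambda>n. \<Prod>i<n. enn_powr (u i x) (a i))" for x
  have [measurable]: "F \<in> borel_measurable M" unfolding F_def by measurable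
  have sum_less: "(\<Sum>i<n. a i) < 1" for n
  proof -
    have "(\<Sum>i<n. a i) < (\<Sum>i<Suc n. a i)" using a(1)[of n] by simp
    also have "\<dots> \<le> (\<Sum>i. a i)"
      using a by (intro sum_le_suminf) (auto simp: sums_iff less_imp_le)
    finally show ?thesis using a by (simp add: sums_iff)
  qed
  have local: "(\<integral>\<^sup>+x\<in>B. F x \<partial>M) \<le> L" if [measurable]: "B \<in> sets M" and fin: "emeasure M B < \<infinity>" for B
  proof (cases "emeasure M B = 0")
    case True
    then show ?thesis by (simp add: nn_integral_null_set null_sets_def)
  next
    case False
    define t where "t n = enn_powr (emeasure M B) (1 - (\<Sum>i<n. a i))" for n
    have "(\<lambda>n. \<Sum>i<n. a i) \<longlonglongrightarrow> 1" using a by (simp add: sums_def)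
    then have "t \<longlonglongrightarrow> enn_powr (emeasure M B) (1 - 1)"
      unfolding t_def using False fin
      by (intro tendsto_enn_powr_exponent tendsto_intros) (auto simp: zero_less_iff_neq_zero)
    moreover have "enn_powr (emeasure M B) (1 - 1) = 1"
      using False fin by (cases "emeasure M B") (auto simp: enn_powr_ennreal)
    ultimately have t: "t \<longlonglongrightarrow> 1" by simp
    have "(\<integral>\<^sup>+x. (\<Prod>i<n. enn_powr (u i x) (a i)) * indicator B x \<partial>M) \<le> K n * t n" for n
    proof -
      define a' where "a' i = (if i < n then a i else 1 - (\<Sum>i<n. a i))" for i
      define u' where "u' i = (if i < n then u i else indicator B)" for i
      have eq: "(\<Prod>i<n. enn_powr (u i x) (a i)) * indicator B x = (\<Prod>i<Suc n. enn_powr (u' i x) (a' i))" for x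
        by (simp add: a'_def u'_def indicator_def)
      have "(\<integral>\<^sup>+x. (\<Prod>i<n. enn_powr (u i x) (a i)) * indicator B x \<partial>M)
          \<le> (\<Prod>i<Suc n. enn_powr (\<integral>\<^sup>+x. u' i x \<partial>M) (a' i))"
        unfolding eq using a sum_less[of n]
        by (intro nn_integral_Holder_prod) (auto simp: a'_def u'_def)
      also have "\<dots> = (\<Prod>i<n. enn_powr (\<integral>\<^sup>+x. u i x \<partial>M) (a i)) * t n"
        by (simp add: a'_def u'_def t_def)
      also have "\<dots> \<le> K n * t n" by (intro mult_right_mono K) simp
      finally show ?thesis .
    qed
    then have "liminf (\<lambda>n. \<integral>\<^sup>+x. (\<Prod>i<n. enn_powr (u i x) (a i)) * indicator B x \<partial>M) \<le> liminf (\<lambda>n. K n * t n)"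
      by (intro Liminf_mono) auto
    also have "(\<lambda>n. K n * t n) \<longlonglongrightarrow> L * 1"
      using L t by (intro tendsto_mult_ennreal) auto
    then have "liminf (\<lambda>n. K n * t n) = L" by (simp add: lim_imp_Liminf)
    finally have le: "liminf (\<lambda>n. \<integral>\<^sup>+x. (\<Prod>i<n. enn_powr (u i x) (a i)) * indicator B x \<partial>M) \<le> L" .
    have "(\<integral>\<^sup>+x\<in>B. F x \<partial>M) = (\<integral>\<^sup>+x. liminf (\<lambda>n. (\<Prod>i<n. enn_powr (u i x) (a i)) * indicator B x) \<partial>M)"
      by (intro nn_integral_cong) (auto simp: F_def indicator_def Liminf_const)
    also have "\<dots> \<le> liminf (\<lambda>n. \<integral>\<^sup>+x. (\<Prod>i<n. enn_powr (u i x) (a i)) * indicator B x \<partial>M)"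
      by (intro nn_integral_liminf) auto
    finally show ?thesis using le by simp
  qed
  obtain A :: "nat \<Rightarrow> 'a set" where A: "range A \<subseteq> sets M" "(\<Union>i. A i) = space M"
      "\<And>i. emeasure M (A i) \<noteq> \<infinity>" "incseq A"
    by (rule sigma_finite_incseq) blast
  have [measurable]: "A j \<in> sets M" for j using A(1) by auto
  have "(\<integral>\<^sup>+x. F x \<partial>M) = (\<integral>\<^sup>+x. (SUP j. F x * indicator (A j) x) \<partial>M)"
  proof (intro nn_integral_cong antisym)
    fix x assume "x \<in> space M"
    then obtain j where "x \<in> A j" using A(2) by auto
    then show "F x \<le> (SUP j. F x * indicator (A j) x)"
      by (intro SUP_upper2[of j]) auto
  qed (auto intro!: SUP_least simp: indicator_def)
  also have "\<dots> = (SUP j. \<integral>\<^sup>+x\<in>A j. F x \<partial>M)"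
    using A(4) by (intro nn_integral_monotone_convergence_SUP)
      (auto simp: incseq_def le_fun_def indicator_def)
  also have "\<dots> \<le> L" using A by (intro SUP_least local) (auto simp: less_top)
  finally show ?thesis by (simp add: F_def)
qed

lemma sigma_finite_lebesgue: "sigma_finite_measure (lebesgue :: 'a::euclidean_space measure)"
proof
  obtain A :: "'a set set" where A: "countable A" "A \<subseteq> sets lborel" "\<Union>A = space lborel"
    "\<forall>a\<in>A. emeasure lborel a \<noteq> \<infinity>"
    using lborel.sigma_finite_countable by blast
  then show "\<exists>A. countable A \<and> A \<subseteq> sets lebesgue \<and> \<Union>A = space (lebesgue :: 'a measure)
      \<and> (\<forall>a\<in>A. emeasure lebesgue a \<noteq> \<infinity>)"
    by (intro exI[of _ A]) (auto simp: subset_iff emeasure_completion)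
qed

lemma avg_Holder:
  assumes B: "B \<in> dyadic" and a: "0 < a" "a < 1"
    and [measurable]: "f \<in> borel_measurable lebesgue" "g \<in> borel_measurable lebesgue"
    and h: "AE x in lebesgue. h x = enn_powr (f x) a * enn_powr (g x) (1 - a)"
  shows "avg B h \<le> enn_powr (avg B f) a * enn_powr (avg B g) (1 - a)"
proof -
  note [measurable] = sets_dyadic[OF B]
  define c where "c = inverse (emeasure lebesgue B)"
  have avg: "avg B k = (\<integral>\<^sup>+x\<in>B. k x \<partial>lebesgue) * c" for k
    by (simp only: avg_def divide_ennreal_def c_def)
  have "(\<integral>\<^sup>+x\<in>B. h x \<partial>lebesgue)
      = (\<integral>\<^sup>+x. enn_powr (f x * indicator B x) a * enn_powr (g x * indicator B x) (1 - a) \<partial>lebesgue)"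
    using h by (intro nn_integral_cong_AE) (auto elim!: eventually_mono simp: indicator_def)
  also have "\<dots> \<le> enn_powr (\<integral>\<^sup>+x\<in>B. f x \<partial>lebesgue) a * enn_powr (\<integral>\<^sup>+x\<in>B. g x \<partial>lebesgue) (1 - a)"
    using a by (intro nn_integral_Holder) auto
  finally have "avg B h \<le> enn_powr (\<integral>\<^sup>+x\<in>B. f x \<partial>lebesgue) a * enn_powr (\<integral>\<^sup>+x\<in>B. g x \<partial>lebesgue) (1 - a) * c"
    unfolding avg by (rule mult_right_mono) simp
  also have "c = enn_powr c a * enn_powr c (1 - a)"
    by (simp add: enn_powr_add[symmetric])
  finally show ?thesis
    by (simp add: avg enn_powr_mult ac_simps)
qed

lemma one_le_A_const:
  fixes w :: "real ^ 'n \<Rightarrow> real"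
  assumes w: "weight w" and q: "1 < q"
  shows "1 \<le> A_const q w"
proof -
  have [measurable]: "w \<in> borel_measurable lebesgue" and pos: "AE x in lebesgue. 0 < w x"
    using w by (auto simp: weight_def)
  obtain B where B: "B \<in> (dyadic :: (real ^ 'n) set set)"
    by (auto simp: dyadic_def dyadic_gen_def)
  have "AE x in lebesgue. 1 = enn_powr (ennreal (w x)) (1 / q) * enn_powr (ennreal (dual_weight q w x)) (1 - 1 / q)"
    using pos
  proof eventually_elim
    fix x assume x: "0 < w x"
    have "- 1 / (q - 1) * (1 - 1 / q) = - (1 / q)" using q by (simp add: divide_simps)
    then show "1 = enn_powr (ennreal (w x)) (1 / q) * enn_powr (ennreal (dual_weight q w x)) (1 - 1 / q)"
      using x by (simp add: enn_powr_ennreal dual_weight_def powr_powr ennreal_mult[symmetric]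
        powr_add[symmetric] del: minus_divide_left)
  qed
  from avg_Holder[OF B _ _ _ _ this] have "avg B (\<lambda>_. 1) \<le> enn_powr (avg B (\<lambda>x. ennreal (w x))) (1 / q)
      * enn_powr (avg B (\<lambda>x. ennreal (dual_weight q w x))) (1 - 1 / q)"
    using q by simp
  also have "avg B (\<lambda>_. 1) = 1"
    using emeasure_dyadic[OF B] sets_dyadic[OF B] by (simp add: avg_def)
  finally have "1 \<le> enn_powr (enn_powr (avg B (\<lambda>x. ennreal (w x))) (1 / q)
      * enn_powr (avg B (\<lambda>x. ennreal (dual_weight q w x))) (1 - 1 / q)) q"
    using q by (intro one_le_enn_powr) auto
  also have "\<dots> = avg B (\<lambda>x. ennreal (w x)) * enn_powr (avg B (\<lambda>x. ennreal (dual_weight q w x))) (q - 1)"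
    using q by (simp add: enn_powr_mult enn_powr_enn_powr left_diff_distrib)
  also have "\<dots> \<le> A_const q w"
    unfolding A_const_def using B by (rule SUP_upper)
  finally show ?thesis .
qed

lemma avg_le_Lp_norm:
  fixes f w :: "real ^ 'n \<Rightarrow> real"
  assumes w: "weight w" and q: "1 < q" and B: "B \<in> dyadic" and [measurable]: "f \<in> borel_measurable lebesgue"
  shows "avg B (\<lambda>x. ennreal \<bar>f x\<bar>) \<le> Lp_norm_real q w f
    * enn_powr (avg B (\<lambda>x. ennreal (dual_weight q w x))) (1 / conj_exp q)
    * enn_powr (inverse (emeasure lebesgue B)) (1 / q)"
proof -
  have [measurable]: "w \<in> borel_measurable lebesgue" and pos: "AE x in lebesgue. 0 < w x"
    using w by (auto simp: weight_def)
  define h where "h x = enn_powr (ennreal \<bar>f x\<bar>) q * ennreal (w x)" for x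
  have [measurable]: "h \<in> borel_measurable lebesgue" by (simp add: h_def[abs_def])
  have c: "1 - 1 / q = 1 / conj_exp q" using conj_exp[OF q] by simp
  have "AE x in lebesgue. ennreal \<bar>f x\<bar> = enn_powr (h x) (1 / q) * enn_powr (ennreal (dual_weight q w x)) (1 - 1 / q)"
    using pos
  proof eventually_elim
    fix x assume x: "0 < w x"
    have e: "- 1 / (q - 1) * (1 - 1 / q) = - (1 / q)" using q by (simp add: divide_simps)
    have "enn_powr (ennreal (w x)) (1 / q) * enn_powr (ennreal (dual_weight q w x)) (1 - 1 / q) = 1"
      using x e by (simp add: enn_powr_ennreal dual_weight_def powr_powr ennreal_mult[symmetric]
        powr_add[symmetric] del: minus_divide_left)
    then show "ennreal \<bar>f x\<bar> = enn_powr (h x) (1 / q) * enn_powr (ennreal (dual_weight q w x)) (1 - 1 / q)"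
      using q by (simp add: h_def enn_powr_mult enn_powr_enn_powr mult.assoc)
  qed
  from avg_Holder[OF B _ _ _ _ this] have "avg B (\<lambda>x. ennreal \<bar>f x\<bar>)
      \<le> enn_powr (avg B h) (1 / q) * enn_powr (avg B (\<lambda>x. ennreal (dual_weight q w x))) (1 / conj_exp q)"
    using q by (simp add: c)
  also have "enn_powr (avg B h) (1 / q)
      \<le> enn_powr ((\<integral>\<^sup>+x. h x \<partial>lebesgue) * inverse (emeasure lebesgue B)) (1 / q)"
    unfolding avg_def divide_ennreal_def using q
    by (intro enn_powr_mono mult_right_mono nn_integral_mono) (auto simp: indicator_def)
  also have "\<dots> = Lp_norm_real q w f * enn_powr (inverse (emeasure lebesgue B)) (1 / q)"
    by (simp add: enn_powr_mult Lp_norm_real_def Lp_norm_def h_def)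
  finally show ?thesis by (simp add: mult_right_mono ac_simps)
qed

lemma dyadic_E_eq_avg:
  assumes "B \<in> dyadic_gen k" "x \<in> B"
  shows "dyadic_E k f x = avg B f"
proof -
  have "dyadic_E k f x = (\<Sum>\<^sub>\<infinity>B'\<in>{B}. avg B' f * indicator B' x)"
    unfolding dyadic_E_def
  proof (rule infsum_cong_neutral)
    fix B' assume "B' \<in> dyadic_gen k - {B}"
    then have "x \<notin> B'" using dyadic_gen_unique[OF assms(1) _ assms(2)] by blast
    then show "avg B' f * indicator B' x = 0" by simp
  qed (use assms in auto)
  then show ?thesis using assms by simp
qed

lemma dyadic_nonempty: "B \<in> dyadic \<Longrightarrow> B \<noteq> {}"
  using emeasure_dyadic by fastforce

lemma inf_prod_avg:
  fixes w f :: "nat \<Rightarrow> real ^ 'n \<Rightarrow> real"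
  assumes ps: "\<And>i. 1 < ps i" and p: "(\<lambda>i. 1 / ps i) sums (1 / p)" and w: "\<And>i. weight (w i)"
    and E_finite: "\<And>k x. inf_prod_finite
          (\<lambda>i. enn_powr (dyadic_E k (\<lambda>y. ennreal (dual_weight (ps i) (w i) y)) x) (1 / conj_exp (ps i)))"
    and f: "f \<in> Lp_prod ps w" and B: "B \<in> dyadic"
  shows "inf_prod_conv (\<lambda>i. avg B (\<lambda>y. ennreal \<bar>f i y\<bar>))"
    and "inf_prod (\<lambda>i. Lp_norm_real (ps i) (w i) (f i)) = 0 \<Longrightarrow> inf_prod (\<lambda>i. avg B (\<lambda>y. ennreal \<bar>f i y\<bar>)) = 0"
proof -
  define c where "c = inverse (emeasure lebesgue B)"
  have c: "0 < c" "c < \<infinity>"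
    using emeasure_dyadic[OF B] by (auto simp: c_def less_top[symmetric] zero_less_iff_neq_zero)
  obtain k where k: "B \<in> dyadic_gen k" using B by (auto simp: dyadic_def)
  obtain x where x: "x \<in> B" using dyadic_nonempty[OF B] by auto
  define N where "N = (\<lambda>i. Lp_norm_real (ps i) (w i) (f i))"
  define T where "T = (\<lambda>i. enn_powr (avg B (\<lambda>x. ennreal (dual_weight (ps i) (w i) x))) (1 / conj_exp (ps i)))"
  have N: "(\<lambda>n. \<Prod>i<n. N i) \<longlonglongrightarrow> inf_prod N" "inf_prod N < \<infinity>"
    using f inf_prod_LIMSEQ by (auto simp: Lp_prod_def inf_prod_finite_def N_def)
  have T: "(\<lambda>n. \<Prod>i<n. T i) \<longlonglongrightarrow> inf_prod T" "inf_prod T < \<infinity>"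
    using E_finite[of k x] inf_prod_LIMSEQ
    by (auto simp: inf_prod_finite_def T_def dyadic_E_eq_avg[OF k x])
  have R: "(\<lambda>n. \<Prod>i<n. enn_powr c (1 / ps i)) \<longlonglongrightarrow> enn_powr c (1 / p)"
    using p c unfolding enn_powr_sum[OF c, symmetric] sums_def by (rule_tac tendsto_enn_powr_exponent)
  have "(\<lambda>n. (\<Prod>i<n. N i) * (\<Prod>i<n. T i) * (\<Prod>i<n. enn_powr c (1 / ps i)))
      \<longlonglongrightarrow> inf_prod N * inf_prod T * enn_powr c (1 / p)"
    using N T R c by (intro tendsto_mult_ennreal)
      (auto simp: less_top[symmetric] ennreal_mult_eq_top_iff)
  then have lim: "(\<lambda>n. \<Prod>i<n. N i * T i * enn_powr c (1 / ps i))
      \<longlonglongrightarrow> inf_prod N * inf_prod T * enn_powr c (1 / p)"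
    by (simp add: prod.distrib)
  have le: "avg B (\<lambda>y. ennreal \<bar>f i y\<bar>) \<le> N i * T i * enn_powr c (1 / ps i)" for i
    unfolding N_def T_def c_def using f by (intro avg_le_Lp_norm w ps B) (auto simp: Lp_prod_def)
  have fin: "inf_prod N * inf_prod T * enn_powr c (1 / p) < \<infinity>"
    using N T c by (auto simp: ennreal_mult_less_top enn_powr_less_top)
  show "inf_prod_conv (\<lambda>i. avg B (\<lambda>y. ennreal \<bar>f i y\<bar>))"
    by (rule inf_prod_dominated[OF le lim fin])
  have "inf_prod (\<lambda>i. avg B (\<lambda>y. ennreal \<bar>f i y\<bar>)) \<le> inf_prod N * inf_prod T * enn_powr c (1 / p)"
    by (rule inf_prod_dominated[OF le lim fin])
  then show "inf_prod (\<lambda>i. avg B (\<lambda>y. ennreal \<bar>f i y\<bar>)) = 0" if "inf_prod (\<lambda>i. Lp_norm_real (ps i) (w i) (f i)) = 0"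
    using that by (simp add: N_def)
qed

lemma Buckley_const_prod_LIMSEQ:
  fixes w :: "nat \<Rightarrow> real ^ 'n \<Rightarrow> real"
  assumes ps: "\<And>i. 1 < ps i" and w: "\<And>i. weight (w i)"
  defines "C \<equiv> inf_prod (\<lambda>i. enn_powr (A_const (ps i) (w i)) (conj_exp (ps i) / ps i))
                  * inf_prod (\<lambda>i. ennreal (ps i powr (conj_exp (ps i) / ps i)))
                  * inf_prod (\<lambda>i. ennreal (conj_exp (ps i)))"
  shows "(\<lambda>n. \<Prod>i<n. Buckley_const (ps i) (w i)) \<longlonglongrightarrow> C" and "1 \<le> C"
proof -
  have e: "0 < conj_exp (ps i) / ps i" for i
    using ps[of i] conj_exp_gt_1[OF ps[of i]] by simp
  define c1 where "c1 = (\<lambda>i. enn_powr (A_const (ps i) (w i)) (conj_exp (ps i) / ps i))"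
  define c2 where "c2 = (\<lambda>i. ennreal (ps i powr (conj_exp (ps i) / ps i)))"
  define c3 where "c3 = (\<lambda>i. ennreal (conj_exp (ps i)))"
  have C: "C = inf_prod c1 * inf_prod c2 * inf_prod c3"
    by (simp add: C_def c1_def c2_def c3_def)
  have "1 \<le> c1 i" "1 \<le> c2 i" "1 \<le> c3 i" for i
    using e[of i] ps[of i] ge_one_powr_ge_zero[of "ps i"] conj_exp_gt_1[OF ps[of i]]
    by (auto simp: c1_def c2_def c3_def intro!: one_le_enn_powr one_le_A_const w)
  note L1 = LIMSEQ_one_le_prod[of c1, OF this(1)] and L2 = LIMSEQ_one_le_prod[of c2, OF this(2)]
    and L3 = LIMSEQ_one_le_prod[of c3, OF this(3)]
  have "1 \<le> inf_prod c1 * inf_prod c2"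
    using mult_mono[OF L1(2) L2(2)] by simp
  then show "1 \<le> C" unfolding C using mult_mono[OF _ L3(2)] by fastforce
  have "inf_prod c1 \<noteq> 0" "inf_prod c2 \<noteq> 0" "inf_prod c3 \<noteq> 0"
    using L1(2) L2(2) L3(2) by auto
  then have "(\<lambda>n. (\<Prod>i<n. c1 i) * (\<Prod>i<n. c2 i) * (\<Prod>i<n. c3 i)) \<longlonglongrightarrow> C"
    unfolding C using L1(1) L2(1) L3(1) by (intro tendsto_mult_ennreal) auto
  then show "(\<lambda>n. \<Prod>i<n. Buckley_const (ps i) (w i)) \<longlonglongrightarrow> C"
    by (simp add: Buckley_const_def prod.distrib c1_def c2_def c3_def)
qed

theorem corollary3p5:
  fixes ps :: "nat \<Rightarrow> real" and p :: real
    and \<omega> \<sigma> :: "nat \<Rightarrow> real ^ 'n \<Rightarrow> real"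
    and v :: "real ^ 'n \<Rightarrow> ennreal"
    and C :: ennreal
  assumes ps: "\<And>i. 1 < ps i"
    and p: "(\<lambda>i. 1 / ps i) sums (1 / p)"
    and weight: "\<And>i. weight (\<omega> i)"
    and \<sigma>_def: "\<And>i. \<sigma> i = dual_weight (ps i) (\<omega> i)"
    and E_finite: "\<And>k x. inf_prod_finite
          (\<lambda>i. enn_powr (dyadic_E k (\<lambda>y. ennreal (\<sigma> i y)) x) (1 / conj_exp (ps i)))"
    and \<sigma>_prod_pos: "AE x in lebesgue.
          inf_prod_conv (\<lambda>i. ennreal (\<sigma> i x powr (1 / ps i))) \<and>
          0 < inf_prod (\<lambda>i. ennreal (\<sigma> i x powr (1 / ps i)))"
    and \<sigma>_cubes: "\<And>B. B \<in> dyadic \<Longrightarrow> (\<lambda>i x. \<sigma> i x * indicator B x) \<in> Lp_prod ps \<omega>"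
    and v_def: "v = prod_weight p ps \<omega>"
    and v_conv: "AE x in lebesgue. inf_prod_conv (\<lambda>i. ennreal (\<omega> i x powr (p / ps i)))"
    and log_sum: "summable (\<lambda>i. ln (ps i) / ps i)"
    and A_star: "A_star ps \<omega>"
    and C_def: "C = inf_prod (\<lambda>i. enn_powr (A_const (ps i) (\<omega> i)) (conj_exp (ps i) / ps i))
                  * inf_prod (\<lambda>i. ennreal (ps i powr (conj_exp (ps i) / ps i)))
                  * inf_prod (\<lambda>i. ennreal (conj_exp (ps i)))"
  shows "\<forall>f \<in> Lp_prod ps \<omega>.
           Lp_norm p v (gen_max f) \<le> C * inf_prod (\<lambda>i. Lp_norm_real (ps i) (\<omega> i) (f i))"
proof
  fix f assume f: "f \<in> Lp_prod ps \<omega>"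
  have [measurable]: "f i \<in> borel_measurable lebesgue" "\<omega> i \<in> borel_measurable lebesgue" for i
    using f weight by (auto simp: Lp_prod_def weight_def)
  have "0 < (\<Sum>i. 1 / ps i)"
    using p ps by (intro suminf_pos) (auto simp: sums_iff intro: less_trans[of 0 1])
  then have p_pos: "0 < p" using p by (simp add: sums_iff)
  define N where "N = (\<lambda>i. Lp_norm_real (ps i) (\<omega> i) (f i))"
  have N_lim: "(\<lambda>n. \<Prod>i<n. N i) \<longlonglongrightarrow> inf_prod N"
    using f inf_prod_LIMSEQ by (auto simp: Lp_prod_def inf_prod_finite_def N_def)
  note avg_prod = inf_prod_avg[OF ps p weight E_finite[unfolded \<sigma>_def] f]
  show "Lp_norm p v (gen_max f) \<le> C * inf_prod N"
    unfolding N_def[symmetric]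
  proof (cases "inf_prod N = 0")
    case True
    have "gen_max f x \<le> 0" for x
      unfolding gen_max_def using avg_prod(2) True by (intro SUP_least) (auto simp: N_def)
    then show ?thesis by (simp add: Lp_norm_def)
  next
    case False
    define Mf where "Mf i = maximal_fn dyadic lebesgue (\<lambda>y. ennreal \<bar>f i y\<bar>)" for i
    have [measurable]: "Mf i \<in> borel_measurable lebesgue" for i
      unfolding Mf_def using sets_dyadic by (intro measurable_maximal_fn countable_dyadic) auto
    have gen_max_le: "gen_max f x \<le> liminf (\<lambda>n. \<Prod>i<n. Mf i x)" for x
      unfolding gen_max_def
    proof (rule SUP_least, safe)
      fix B :: "(real ^ 'n) set" assume B: "B \<in> dyadic" "x \<in> B"
      have "inf_prod (\<lambda>i. avg B (\<lambda>y. ennreal \<bar>f i y\<bar>)) = liminf (\<lambda>n. \<Prod>i<n. avg B (\<lambda>y. ennreal \<bar>f i y\<bar>))"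
        using inf_prod_LIMSEQ[OF avg_prod(1)[OF B(1)]] by (simp add: lim_imp_Liminf)
      also have "\<dots> \<le> liminf (\<lambda>n. \<Prod>i<n. Mf i x)"
        unfolding Mf_def using B
        by (intro Liminf_mono always_eventually allI prod_mono_ennreal avg_le_maximal_fn)
      finally show "inf_prod (\<lambda>i. avg B (\<lambda>y. ennreal \<bar>f i y\<bar>)) \<le> liminf (\<lambda>n. \<Prod>i<n. Mf i x)" .
    qed
    define u where "u i x = enn_powr (Mf i x) (ps i) * ennreal (\<omega> i x)" for i x
    have [measurable]: "u i \<in> borel_measurable lebesgue" for i by (simp add: u_def[abs_def])
    have u_powr: "enn_powr (u i x) (p / ps i) = enn_powr (Mf i x) p * ennreal (\<omega> i x powr (p / ps i))"
      if "0 < \<omega> i x" for i x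
      using that ps[of i] by (simp add: u_def enn_powr_mult enn_powr_enn_powr enn_powr_ennreal)
    have "AE x in lebesgue. \<forall>i. 0 < \<omega> i x"
      using weight by (simp add: AE_all_countable weight_def)
    with v_conv have pointwise: "AE x in lebesgue. enn_powr (gen_max f x) p * v x
        \<le> liminf (\<lambda>n. \<Prod>i<n. enn_powr (u i x) (p / ps i))"
    proof eventually_elim
      fix x assume conv: "inf_prod_conv (\<lambda>i. ennreal (\<omega> i x powr (p / ps i)))" and pos: "\<forall>i. 0 < \<omega> i x"
      have "enn_powr (gen_max f x) p * v x \<le> enn_powr (liminf (\<lambda>n. \<Prod>i<n. Mf i x)) p * v x"
        using p_pos by (intro mult_right_mono enn_powr_mono gen_max_le) auto
      also have "\<dots> = liminf (\<lambda>n. enn_powr (\<Prod>i<n. Mf i x) p) * v x"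
        using p_pos by (simp add: liminf_enn_powr)
      also have "\<dots> \<le> liminf (\<lambda>n. enn_powr (\<Prod>i<n. Mf i x) p * (\<Prod>i<n. ennreal (\<omega> i x powr (p / ps i))))"
        unfolding v_def prod_weight_def by (intro liminf_mult_le inf_prod_LIMSEQ conv)
      also have "\<dots> = liminf (\<lambda>n. \<Prod>i<n. enn_powr (u i x) (p / ps i))"
        using pos by (simp add: u_powr enn_powr_prod prod.distrib)
      finally show "enn_powr (gen_max f x) p * v x \<le> liminf (\<lambda>n. \<Prod>i<n. enn_powr (u i x) (p / ps i))" .
    qed
    define K where "K n = enn_powr ((\<Prod>i<n. Buckley_const (ps i) (\<omega> i)) * (\<Prod>i<n. N i)) p" for n
    have K_le: "(\<Prod>i<n. enn_powr (\<integral>\<^sup>+x. u i x \<partial>lebesgue) (p / ps i)) \<le> K n" for n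
      unfolding K_def prod.distrib[symmetric] enn_powr_prod
    proof (rule prod_mono_ennreal)
      fix i
      have "(\<integral>\<^sup>+x. u i x \<partial>lebesgue) \<le> enn_powr (Buckley_const (ps i) (\<omega> i)) (ps i)
          * (\<integral>\<^sup>+x. enn_powr (ennreal \<bar>f i x\<bar>) (ps i) * ennreal (\<omega> i x) \<partial>lebesgue)"
        unfolding u_def Mf_def using A_star
        by (intro maximal_fn_weighted_bound weight ps) (auto simp: A_star_def A_class_def)
      also have "\<dots> = enn_powr (Buckley_const (ps i) (\<omega> i) * N i) (ps i)"
        using ps[of i] by (simp add: enn_powr_mult N_def Lp_norm_real_def Lp_norm_def enn_powr_enn_powr)
      finally have "enn_powr (\<integral>\<^sup>+x. u i x \<partial>lebesgue) (p / ps i)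
          \<le> enn_powr (enn_powr (Buckley_const (ps i) (\<omega> i) * N i) (ps i)) (p / ps i)"
        using p_pos ps[of i] by (intro enn_powr_mono) auto
      then show "enn_powr (\<integral>\<^sup>+x. u i x \<partial>lebesgue) (p / ps i) \<le> enn_powr (Buckley_const (ps i) (\<omega> i) * N i) p"
        using ps[of i] by (simp add: enn_powr_enn_powr)
    qed
    have K_lim: "K \<longlonglongrightarrow> enn_powr (C * inf_prod N) p"
      unfolding K_def C_def
      using Buckley_const_prod_LIMSEQ[of ps \<omega>, OF ps weight] N_lim False
      by (intro tendsto_enn_powr p_pos tendsto_mult_ennreal) auto
    have a: "(\<lambda>i. p / ps i) sums 1"
      using sums_mult[OF p, of p] p_pos by simp
    have a_pos: "0 < p / ps i" for i
      using p_pos ps[of i] by simp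
    have "(\<integral>\<^sup>+x. enn_powr (gen_max f x) p * v x \<partial>lebesgue)
        \<le> (\<integral>\<^sup>+x. liminf (\<lambda>n. \<Prod>i<n. enn_powr (u i x) (p / ps i)) \<partial>lebesgue)"
      using pointwise by (rule nn_integral_mono_AE)
    also have "\<dots> \<le> enn_powr (C * inf_prod N) p"
      using a_pos a K_le K_lim
      by (intro nn_integral_Holder_infinite_prod[where K = K] sigma_finite_lebesgue) auto
    finally have "enn_powr (\<integral>\<^sup>+x. enn_powr (gen_max f x) p * v x \<partial>lebesgue) (1 / p)
        \<le> enn_powr (enn_powr (C * inf_prod N) p) (1 / p)"
      using p_pos by (intro enn_powr_mono) auto
    then show ?thesis
      using p_pos by (simp add: Lp_norm_def enn_powr_enn_powr)
  qed
qed

end
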